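(* The $1$-bounded language inclusion problem for eNTA is decidable. That is, there is an algorithm that, given two eNTAs $A_1$ and $A_2$ over the same set $\Sigma$ of observable actions, decides whether $\mathfrak L_1(A_1)\subseteq\mathfrak L_1(A_2)$.
   Context: **Automata.** An eNTA is a timed automaton $A=(\mathcal Q,q_0,\Sigma\cup\{\epsilon\},\mathcal C,\mathcal T)$ with the following components. - $\mathcal Q$ is a finite set of locations and $q_0$ is the initial location. - $\Sigma$ is a finite set of observable actions and $\epsilon$ is the silent action. - $\mathcal C$ is a finite set of clocks. - $\mathcal T$ is a finite set of transitions $(q,a,g,\mathcal C_{rst},q')$ with $\mathcal C_{rst}\subseteq\mathcal C$ and guards that are finite conjunctions of constraints $c\sim n$, with $\sim\in\{<,\le,=,\ge,>\}$ and $n\in\mathbb N_0$. **Runs.** Runs start at $(q_0,\mathbf 0)$ and alternate real delays (all clocks increase equally) with transitions, which are enabled when the guard holds and reset $\mathcal C_{rst}$. Silent transitions may occur arbitrarily often, so runs are not bounded in length or time. The observable timed trace of a run is the sequence of pairs $(t_i,a_i)$, where $a_i\ne\epsilon$ is the action of the $i$-th transition and $t_i$ is the total elapsed time when it is taken. **Language.** $\mathfrak L(A)$ is the set of observable timed traces of all finite runs, with all locations accepting. $\mathfrak L_1(A)=\{w\in\mathfrak L(A):|w|\le1\}$. *)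

theory Defs
  imports Complex_Main "HOL-Library.Nat_Bijection"
begin

datatype cmp = Lt | Le | Eq | Ge | Gt

fun cmp_sat :: "cmp \<Rightarrow> real \<Rightarrow> real \<Rightarrow> bool" where
  "cmp_sat Lt x n = (x < n)"
| "cmp_sat Le x n = (x \<le> n)"
| "cmp_sat Eq x n = (x = n)"
| "cmp_sat Ge x n = (x \<ge> n)"
| "cmp_sat Gt x n = (x > n)"

type_synonym atom = "nat \<times> cmp \<times> nat"
type_synonym guard = "atom list"

text \<open>Action None is the silent action epsilon; Some a is the observable action a.\<close>
type_synonym edge = "nat \<times> nat option \<times> guard \<times> nat list \<times> nat"

record enta =
  locs  :: "nat list"
  init  :: nat
  acts  :: "nat list"
  clks  :: "nat list"
  edges :: "edge list"

definition wf_enta :: "enta \<Rightarrow> bool" where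
  "wf_enta A \<longleftrightarrow> init A \<in> set (locs A) \<and>
     (\<forall>(q, a, g, R, q') \<in> set (edges A).
        q \<in> set (locs A) \<and> q' \<in> set (locs A) \<and>
        (\<forall>b. a = Some b \<longrightarrow> b \<in> set (acts A)) \<and>
        (\<forall>(c, r, n) \<in> set g. c \<in> set (clks A)) \<and>
        set R \<subseteq> set (clks A))"

definition guard_sat :: "guard \<Rightarrow> (nat \<Rightarrow> real) \<Rightarrow> bool" where
  "guard_sat g v \<longleftrightarrow> (\<forall>(c, r, n) \<in> set g. cmp_sat r (v c) (real n))"

inductive reach :: "enta \<Rightarrow> nat \<Rightarrow> (nat \<Rightarrow> real) \<Rightarrow> real \<Rightarrow> (real \<times> nat) list \<Rightarrow> bool"
  for A :: enta where
  start: "reach A (init A) (\<lambda>_. 0) 0 []"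
| delay: "reach A q v t w \<Longrightarrow> d \<ge> 0 \<Longrightarrow> reach A q (\<lambda>c. v c + d) (t + d) w"
| step: "reach A q v t w \<Longrightarrow> (q, a, g, R, q') \<in> set (edges A) \<Longrightarrow> guard_sat g v \<Longrightarrow>
         reach A q' (\<lambda>c. if c \<in> set R then 0 else v c) t
           (w @ (case a of None \<Rightarrow> [] | Some b \<Rightarrow> [(t, b)]))"

definition lang :: "enta \<Rightarrow> (real \<times> nat) list set" where
  "lang A = {w. \<exists>q v t. reach A q v t w}"

definition lang1 :: "enta \<Rightarrow> (real \<times> nat) list set" where
  "lang1 A = {w \<in> lang A. length w \<le> 1}"

datatype recf = Zero | Succ | Proj nat | Comp recf "recf list" | Prec recf recf | Mn recf

inductive eval :: "recf \<Rightarrow> nat list \<Rightarrow> nat \<Rightarrow> bool" where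
  zero: "eval Zero xs 0"
| succ: "eval Succ (x # xs) (Suc x)"
| proj: "i < length xs \<Longrightarrow> eval (Proj i) xs (xs ! i)"
| comp: "length ys = length gs \<Longrightarrow> (\<forall>j < length gs. eval (gs ! j) xs (ys ! j)) \<Longrightarrow>
         eval f ys y \<Longrightarrow> eval (Comp f gs) xs y"
| prec0: "eval f xs y \<Longrightarrow> eval (Prec f g) (0 # xs) y"
| precS: "eval (Prec f g) (n # xs) r \<Longrightarrow> eval g (r # n # xs) y \<Longrightarrow>
          eval (Prec f g) (Suc n # xs) y"
| mn: "eval f (n # xs) 0 \<Longrightarrow> (\<forall>m < n. \<exists>y. y > 0 \<and> eval f (m # xs) y) \<Longrightarrow>
       eval (Mn f) xs n"

fun enc_cmp :: "cmp \<Rightarrow> nat" where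
  "enc_cmp Lt = 0" | "enc_cmp Le = 1" | "enc_cmp Eq = 2" | "enc_cmp Ge = 3" | "enc_cmp Gt = 4"

definition enc_atom :: "atom \<Rightarrow> nat" where
  "enc_atom x = (case x of (c, r, n) \<Rightarrow> list_encode [c, enc_cmp r, n])"

definition enc_act :: "nat option \<Rightarrow> nat" where
  "enc_act a = (case a of None \<Rightarrow> 0 | Some b \<Rightarrow> Suc b)"

definition enc_edge :: "edge \<Rightarrow> nat" where
  "enc_edge e = (case e of (q, a, g, R, q') \<Rightarrow>
     list_encode [q, enc_act a, list_encode (map enc_atom g), list_encode R, q'])"

definition enc_enta :: "enta \<Rightarrow> nat" where
  "enc_enta A = list_encode [list_encode (locs A), init A, list_encode (acts A),
                             list_encode (clks A), list_encode (map enc_edge (edges A))]"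

end

theory Submission
  imports Defs
begin

text \<open>
  A run with at most one observable action is a silent run followed by one visible transition, so
  the statement concerns the sets of times at which an action can first be observed. Such a set is
  a union of integer points and open unit intervals, because it is determined by reachability in
  the region graph extended with one clock for absolute time, which is never reset. Only the
  fractional part of that clock has to be kept in a region; its integer part becomes a counter that
  is incremented whenever time passes an integer. The set of regions reachable with counter value
  \<open>n\<close> is a function of the one for \<open>n - 1\<close>, hence the pair of these sets for the two automata
  is ultimately periodic with a computable bound, and inclusion has to be compared only up to this
  bound.

  Regions are numbers whose digits give the location and, for each clock, the capped integer part
  and the rank of the fractional part among all clocks. The code of the automaton serves as a bound
  for everything: locations, clock names and constants are all smaller, so it is also a free name
  for the clock of absolute time.
\<close>

section \<open>Computable functions\<close>

text \<open>A delay below 1 rotates the circle of fractional parts, and the clocks that pass the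
  point 0 carry into their integer parts. Ranks modulo \<open>a + 3\<close> imitate this: adding
  \<open>k\<close> to every rank gives the new rank as remainder and the carry as quotient. All
  clocks, the one of absolute time included, then obey a single rule, without the case distinctions
  of the usual time successor. The price is that ranks are mere labels: a delay \<open>d\<close>
  with \<open>1 - d\<close> strictly between two fractional parts needs a free label there, and
  respacing provides it.

  The two halves of correctness quantify in opposite ways. Completeness shows that every code of a
  region met by a run is reached, whatever ranks the code uses. Soundness shows that a reached code
  is realized for every order-preserving choice of fractional parts.

  Decidability here means a term of \<open>recf\<close>, so all data are numbers, and every
  quantifier of the procedure is bounded by a number computed from the input.\<close>

definition rec_fun :: "nat \<Rightarrow> (nat list \<Rightarrow> nat) \<Rightarrow> bool" where
  "rec_fun k f \<longleftrightarrow> (\<exists>r. \<forall>xs. length xs = k \<longrightarrow> eval r xs (f xs))"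

lemma rec_fun_cong:
  assumes "rec_fun k f" "\<And>xs. length xs = k \<Longrightarrow> f xs = g xs"
  shows "rec_fun k g"
  using assms unfolding rec_fun_def by metis

lemma rec_fun_nth: "i < k \<Longrightarrow> rec_fun k (\<lambda>xs. xs ! i)"
  unfolding rec_fun_def by (metis eval.proj)

lemma rec_fun_comp:
  assumes "rec_fun m f" "\<And>g. g \<in> set gs \<Longrightarrow> rec_fun k g" "length gs = m"
  shows "rec_fun k (\<lambda>xs. f (map (\<lambda>g. g xs) gs))"
proof -
  obtain r where r: "\<And>xs. length xs = m \<Longrightarrow> eval r xs (f xs)"
    using assms(1) unfolding rec_fun_def by blast
  obtain R where R: "\<And>g xs. g \<in> set gs \<Longrightarrow> length xs = k \<Longrightarrow> eval (R g) xs (g xs)"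
    using assms(2) unfolding rec_fun_def by metis
  have "eval (Comp r (map R gs)) xs (f (map (\<lambda>g. g xs) gs))" if "length xs = k" for xs
    by (rule eval.comp[where ys = "map (\<lambda>g. g xs) gs"]) (auto intro!: r R simp: assms(3) that)
  then show ?thesis unfolding rec_fun_def by blast
qed

lemma rec_fun_comp1:
  assumes "rec_fun 1 (\<lambda>ys. f (ys ! 0))" "rec_fun k g"
  shows "rec_fun k (\<lambda>xs. f (g xs))"
  using rec_fun_comp[OF assms(1), of "[g]" k] assms(2) by simp

lemma rec_fun_comp2:
  assumes "rec_fun 2 (\<lambda>ys. f (ys ! 0) (ys ! 1))" "rec_fun k g" "rec_fun k h"
  shows "rec_fun k (\<lambda>xs. f (g xs) (h xs))"
  using rec_fun_comp[OF assms(1), of "[g, h]" k] assms(2,3) by auto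

lemma rec_fun_Suc: "rec_fun k g \<Longrightarrow> rec_fun k (\<lambda>xs. Suc (g xs))"
proof (rule rec_fun_comp1[where f = Suc])
  have "eval Succ xs (Suc (xs ! 0))" if "length xs = 1" for xs
    using that by (cases xs) (auto intro: eval.succ)
  then show "rec_fun 1 (\<lambda>ys. Suc (ys ! 0))"
    unfolding rec_fun_def by blast
qed

lemma rec_fun_const: "rec_fun k (\<lambda>_. c)"
proof (induction c)
  case 0
  then show ?case unfolding rec_fun_def by (metis eval.zero)
qed (rule rec_fun_Suc)

lemma rec_fun_rec_nat:
  assumes "rec_fun k f" "rec_fun (k + 2) g"
  shows "rec_fun (k + 1) (\<lambda>xs. rec_nat (f (tl xs)) (\<lambda>n r. g (r # n # tl xs)) (xs ! 0))"
proof -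
  obtain F G where F: "\<And>xs. length xs = k \<Longrightarrow> eval F xs (f xs)"
    and G: "\<And>xs. length xs = k + 2 \<Longrightarrow> eval G xs (g xs)"
    using assms unfolding rec_fun_def by blast
  have "eval (Prec F G) (n # xs) (rec_nat (f xs) (\<lambda>n r. g (r # n # xs)) n)"
    if "length xs = k" for n xs
    by (induction n) (simp_all add: eval.prec0 F that, metis G eval.precS length_Cons that add_2_eq_Suc')
  then have "eval (Prec F G) xs (rec_nat (f (tl xs)) (\<lambda>n r. g (r # n # tl xs)) (xs ! 0))"
    if "length xs = k + 1" for xs
    using that by (cases xs) auto
  then show ?thesis unfolding rec_fun_def by blast
qed

text \<open>\<open>precS\<close> passes the recursive result first, then the counter, then the
  parameter; this is the reason for the indices 1, 0, 2 under the step function.\<close>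

lemma rec_fun_rec_nat2:
  assumes "rec_fun 1 (\<lambda>xs. f (xs ! 0))" "rec_fun 3 (\<lambda>xs. g (xs ! 1) (xs ! 0) (xs ! 2))"
    and "\<And>x. h 0 x = f x" "\<And>n x. h (Suc n) x = g n (h n x) x"
  shows "rec_fun 2 (\<lambda>xs. h (xs ! 0) (xs ! 1))"
proof -
  have h: "h n x = rec_nat (f x) (\<lambda>n r. g n r x) n" for n x
    by (induction n) (simp_all add: assms)
  show ?thesis
    by (rule rec_fun_cong) (use rec_fun_rec_nat[of 1 "\<lambda>xs. f (xs ! 0)" "\<lambda>xs. g (xs ! 1) (xs ! 0) (xs ! 2)"] assms(1,2) in
        \<open>simp add: numeral_eq_Suc\<close>, auto simp: h numeral_eq_Suc length_Suc_conv)
qed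

lemma rec_fun_add:
  assumes "rec_fun k f" "rec_fun k g"
  shows "rec_fun k (\<lambda>xs. f xs + g xs)"
proof (rule rec_fun_comp2[OF _ assms])
  show "rec_fun 2 (\<lambda>ys. ys ! 0 + ys ! 1)"
    by (rule rec_fun_rec_nat2[where f = "\<lambda>x. x" and g = "\<lambda>_ r _. Suc r"]; (intro rec_fun_Suc rec_fun_nth)?; simp)
qed

lemma rec_fun_diff:
  assumes "rec_fun k f" "rec_fun k g"
  shows "rec_fun k (\<lambda>xs. f xs - g xs)"
proof -
  have "rec_fun 2 (\<lambda>ys. (\<lambda>x y. x - 1) (ys ! 0) (ys ! 1))"
    by (rule rec_fun_rec_nat2[where f = "\<lambda>x. 0" and g = "\<lambda>n _ _. n"]; (intro rec_fun_nth rec_fun_const)?; simp)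
  from rec_fun_comp2[OF this] have pred: "rec_fun k (\<lambda>xs. h xs - 1)" if "rec_fun k h" for h k
    using that by blast
  have "rec_fun 2 (\<lambda>ys. (\<lambda>x y. y - x) (ys ! 0) (ys ! 1))"
    by (rule rec_fun_rec_nat2[where f = "\<lambda>x. x" and g = "\<lambda>_ r _. r - 1"]; (intro rec_fun_nth pred)?; simp)
  from rec_fun_comp2[OF this assms(2,1)] show ?thesis by simp
qed

lemma rec_fun_triangle:
  assumes "rec_fun k f"
  shows "rec_fun k (\<lambda>xs. triangle (f xs))"
proof -
  have "rec_fun 2 (\<lambda>ys. (\<lambda>x y. triangle x) (ys ! 0) (ys ! 1))"
    by (rule rec_fun_rec_nat2[where f = "\<lambda>x. 0" and g = "\<lambda>n r _. r + Suc n"];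
        (intro rec_fun_const rec_fun_add rec_fun_Suc rec_fun_nth)?; simp)
  from rec_fun_comp2[OF this assms assms] show ?thesis by simp
qed

lemma rec_fun_prod_encode:
  assumes "rec_fun k f" "rec_fun k g"
  shows "rec_fun k (\<lambda>xs. prod_encode (f xs, g xs))"
  unfolding prod_encode_def prod.case by (intro rec_fun_add rec_fun_triangle assms)

section \<open>Inverting the pairing function\<close>

definition tri_root :: "nat \<Rightarrow> nat" where
  "tri_root z = (LEAST k. z < triangle (Suc k))"

lemma less_triangle_Suc: "z < triangle (Suc z)"
  by (induction z) auto

text \<open>\<open>prod_encode (m, n)\<close> is \<open>triangle (m + n) + m\<close>, and
  \<open>m\<close> is less than the gap \<open>Suc (m + n)\<close> to the next triangular number.
  The diagonal \<open>m + n\<close> can thus be read off from the code, and both components follow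
  by subtraction.\<close>

lemma tri_root_prod_encode: "tri_root (prod_encode (m, n)) = m + n"
  unfolding tri_root_def
proof (rule Least_equality)
  show "prod_encode (m, n) < triangle (Suc (m + n))"
    by (simp add: prod_encode_def)
next
  fix k assume *: "prod_encode (m, n) < triangle (Suc k)"
  have mono: "triangle i \<le> triangle j" if "i \<le> j" for i j
    using that by (rule lift_Suc_mono_le[rotated]) simp
  show "m + n \<le> k"
    using * mono[of "Suc k" "m + n"] by (cases "m + n \<le> k") (auto simp: prod_encode_def simp del: triangle_Suc)
qed

lemma rec_fun_tri_root: "rec_fun 1 (\<lambda>xs. tri_root (xs ! 0))"
proof -
  \<comment> \<open>Truncated subtraction gives 0 exactly if \<open>z < triangle (Suc k)\<close>, so
    minimization over \<open>k\<close> finds \<open>tri_root z\<close>. This is the only use of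
    \<open>Mn\<close>; all later searches are bounded.\<close>
  have "rec_fun 2 (\<lambda>ys. Suc (ys ! 1) - triangle (Suc (ys ! 0)))"
    by (intro rec_fun_diff rec_fun_Suc rec_fun_triangle rec_fun_nth) simp_all
  then obtain F where "\<And>xs. length xs = 2 \<Longrightarrow> eval F xs (Suc (xs ! 1) - triangle (Suc (xs ! 0)))"
    unfolding rec_fun_def by blast
  from this[of "[k, z]" for k z] have F: "eval F [k, z] (Suc z - triangle (Suc k))" for k z
    by simp
  have "eval (Mn F) [z] (tri_root z)" for z
  proof (rule eval.mn)
    have "z < triangle (Suc (tri_root z))"
      unfolding tri_root_def by (rule LeastI, rule less_triangle_Suc)
    with F[of "tri_root z" z] show "eval F [tri_root z, z] 0"
      by simp
    show "\<forall>m<tri_root z. \<exists>y>0. eval F [m, z] y"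
    proof (intro allI impI exI conjI)
      fix m assume "m < tri_root z"
      then have "\<not> z < triangle (Suc m)"
        unfolding tri_root_def by (rule not_less_Least)
      then show "0 < Suc z - triangle (Suc m)" by simp
    qed (rule F)
  qed
  then have "eval (Mn F) xs (tri_root (xs ! 0))" if "length xs = 1" for xs
    using that by (cases xs) auto
  then show ?thesis unfolding rec_fun_def by blast
qed

section \<open>Computable functions and decidable predicates of one number\<close>

definition pfst :: "nat \<Rightarrow> nat" where "pfst z = fst (prod_decode z)"
definition psnd :: "nat \<Rightarrow> nat" where "psnd z = snd (prod_decode z)"

lemma pfst_encode [simp]: "pfst (prod_encode (m, n)) = m"
  and psnd_encode [simp]: "psnd (prod_encode (m, n)) = n"
  by (simp_all add: pfst_def psnd_def)

text \<open>With a single argument, goals stay within reach of the rules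
  \<open>computable_intros\<close>: a bound variable is added by pairing, so under a quantifier, sum
  or recursion the old argument becomes \<open>pfst z\<close> and the new variables are found in
  \<open>psnd z\<close>.\<close>

definition computable :: "(nat \<Rightarrow> nat) \<Rightarrow> bool" where
  "computable f \<longleftrightarrow> rec_fun 1 (\<lambda>xs. f (xs ! 0))"

definition decidable :: "(nat \<Rightarrow> bool) \<Rightarrow> bool" where
  "decidable P \<longleftrightarrow> computable (\<lambda>x. if P x then 1 else 0)"

named_theorems computable_intros

lemma computable_comp: "computable f \<Longrightarrow> computable g \<Longrightarrow> computable (\<lambda>x. f (g x))"
  unfolding computable_def by (rule rec_fun_comp1[where f = f])

lemma computable_id [computable_intros]: "computable (\<lambda>x. x)"
  unfolding computable_def by (rule rec_fun_nth) simp

lemma computable_const [computable_intros]: "computable (\<lambda>_. c)"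
  unfolding computable_def by (rule rec_fun_const)

lemma computable_Suc [computable_intros]: "computable f \<Longrightarrow> computable (\<lambda>x. Suc (f x))"
  unfolding computable_def by (rule rec_fun_Suc)

lemma computable_add [computable_intros]:
  "computable f \<Longrightarrow> computable g \<Longrightarrow> computable (\<lambda>x. f x + g x)"
  unfolding computable_def by (rule rec_fun_add)

lemma computable_diff [computable_intros]:
  "computable f \<Longrightarrow> computable g \<Longrightarrow> computable (\<lambda>x. f x - g x)"
  for f g :: "nat \<Rightarrow> nat"
  unfolding computable_def by (rule rec_fun_diff)

lemma computable_prod_encode [computable_intros]:
  "computable f \<Longrightarrow> computable g \<Longrightarrow> computable (\<lambda>x. prod_encode (f x, g x))"
  unfolding computable_def by (rule rec_fun_prod_encode)

lemma computable_comp2: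
  assumes "computable (\<lambda>z. f (pfst z) (psnd z))" "computable g" "computable h"
  shows "computable (\<lambda>x. f (g x) (h x))"
  using computable_comp[OF assms(1) computable_prod_encode[OF assms(2,3)]] by simp

lemma prod_decode_tri_root:
  shows "pfst z = z - triangle (tri_root z)" and "psnd z = tri_root z - pfst z"
proof -
  obtain m n where z: "z = prod_encode (m, n)"
    by (metis prod_decode_inverse surj_pair)
  show "pfst z = z - triangle (tri_root z)"
    unfolding z tri_root_prod_encode pfst_encode by (simp add: prod_encode_def)
  show "psnd z = tri_root z - pfst z"
    unfolding z tri_root_prod_encode by simp
qed

lemma computable_pfst [computable_intros]: "computable f \<Longrightarrow> computable (\<lambda>x. pfst (f x))"
  and computable_psnd [computable_intros]: "computable f \<Longrightarrow> computable (\<lambda>x. psnd (f x))"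
proof -
  have 1: "computable pfst"
    unfolding computable_def prod_decode_tri_root
    by (intro rec_fun_diff rec_fun_triangle rec_fun_tri_root rec_fun_nth) simp
  have 2: "computable psnd"
    unfolding computable_def prod_decode_tri_root(2)
    by (intro rec_fun_diff rec_fun_tri_root 1[unfolded computable_def])
  show "computable f \<Longrightarrow> computable (\<lambda>x. pfst (f x))" "computable f \<Longrightarrow> computable (\<lambda>x. psnd (f x))"
    by (rule computable_comp[OF 1] computable_comp[OF 2], assumption)+
qed

lemma computable_rec_nat [computable_intros]:
  assumes "computable f" "computable b"
    and "computable (\<lambda>z. g (pfst z) (pfst (psnd z)) (psnd (psnd z)))"
  shows "computable (\<lambda>x. rec_nat (f x) (\<lambda>n r. g x n r) (b x))"
proof -
  define G where "G z = g (pfst z) (pfst (psnd z)) (psnd (psnd z))" for z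
  have 1: "rec_fun 1 (\<lambda>xs. G (xs ! 0))"
    using assms(3) by (simp add: computable_def G_def)
  have "rec_fun 3 (\<lambda>xs. G (prod_encode (xs ! 2, prod_encode (xs ! 1, xs ! 0))))"
    by (intro rec_fun_comp1[where f = G, OF 1] rec_fun_prod_encode rec_fun_nth) simp_all
  then have 2: "rec_fun 3 (\<lambda>xs. (\<lambda>n r x. g x n r) (xs ! 1) (xs ! 0) (xs ! 2))"
    by (simp add: G_def)
  have 3: "rec_fun 2 (\<lambda>ys. (\<lambda>n x. rec_nat (f x) (\<lambda>n r. g x n r) n) (ys ! 0) (ys ! 1))"
    by (rule rec_fun_rec_nat2[OF _ 2]) (use assms(1) in \<open>simp_all add: computable_def\<close>)
  from rec_fun_comp2[OF this, of 1 "\<lambda>xs. b (xs ! 0)" "\<lambda>xs. xs ! 0"] assms(2)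
  show ?thesis by (simp add: computable_def rec_fun_nth)
qed

lemma computable_rec_nat':
  assumes "computable (\<lambda>x. h x 0)" "computable b"
    and "computable (\<lambda>z. g (pfst z) (pfst (psnd z)) (psnd (psnd z)))"
    and "\<And>x n. h x (Suc n) = g x n (h x n)"
  shows "computable (\<lambda>x. h x (b x))"
proof -
  have "h x n = rec_nat (h x 0) (g x) n" for x n
    by (induction n) (simp_all add: assms(4))
  note h = this[symmetric]
  show ?thesis using computable_rec_nat[where g = g, OF assms(1-3)] by (simp only: h)
qed

lemma computable_funpow [computable_intros]:
  assumes "computable k" "computable b" "computable (\<lambda>z. f (pfst z) (psnd z))"
  shows "computable (\<lambda>x. (f x ^^ k x) (b x))"
proof (rule computable_rec_nat'[where h = "\<lambda>x n. (f x ^^ n) (b x)" and b = k and g = "\<lambda>x _. f x"])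
  show "computable (\<lambda>x. (f x ^^ 0) (b x))"
    by (simp add: assms(2))
  show "computable (\<lambda>z. f (pfst z) (psnd (psnd z)))"
    by (intro computable_comp2[where f = f, OF assms(3)] computable_intros)
qed (simp_all add: assms(1))

lemma computable_mult [computable_intros]:
  assumes "computable f" "computable g"
  shows "computable (\<lambda>x. f x * g x)"
proof -
  have "f x * g x = rec_nat 0 (\<lambda>_ r. r + f x) (g x)" for x
  proof -
    have "f x * n = rec_nat 0 (\<lambda>_ r. r + f x) n" for n by (induction n) auto
    then show ?thesis .
  qed
  then show ?thesis
    by (simp only:) (intro computable_intros assms computable_comp[OF assms(1)])
qed

lemma computable_power [computable_intros]:
  assumes "computable f" "computable g"
  shows "computable (\<lambda>x. f x ^ g x)"
proof (rule computable_rec_nat'[where h = "\<lambda>x n. f x ^ n" and b = g and g = "\<lambda>x _ r. f x * r"])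
  show "computable (\<lambda>x. f x ^ 0)" by (simp add: computable_const)
  show "computable (\<lambda>z. f (pfst z) * psnd (psnd z))"
    by (intro computable_intros computable_comp[OF assms(1)])
qed (simp_all add: assms)

lemma computable_sum [computable_intros]:
  assumes "computable b" "computable (\<lambda>z. f (pfst z) (psnd z))"
  shows "computable (\<lambda>x. \<Sum>i<b x. f x i)"
proof (rule computable_rec_nat'[where h = "\<lambda>x n. \<Sum>i<n. f x i" and b = b and g = "\<lambda>x n r. r + f x n"])
  show "computable (\<lambda>z. psnd (psnd z) + f (pfst z) (pfst (psnd z)))"
    by (intro computable_intros computable_comp2[where f = f, OF assms(2)])
qed (simp_all add: assms computable_const)

lemma decidable_comp: "decidable P \<Longrightarrow> computable g \<Longrightarrow> decidable (\<lambda>x. P (g x))"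
  unfolding decidable_def by (rule computable_comp)

lemma decidable_less [computable_intros]:
  assumes "computable f" "computable g"
  shows "decidable (\<lambda>x. f x < g x)"
proof -
  \<comment> \<open>With truncated subtraction the double complement turns every positive difference
    into 1.\<close>
  have "(if f x < g x then 1 else 0) = 1 - (1 - (g x - f x))" for x
    by auto
  then show ?thesis
    unfolding decidable_def by (simp only:) (intro computable_intros assms)
qed

lemma decidable_not [computable_intros]:
  assumes "decidable P"
  shows "decidable (\<lambda>x. \<not> P x)"
proof -
  have "(if \<not> P x then 1 else 0) = 1 - (if P x then 1 else 0::nat)" for x
    by auto
  then show ?thesis
    unfolding decidable_def by (simp only:) (intro computable_intros assms[unfolded decidable_def])
qed

lemma decidable_conj [computable_intros]:
  assumes "decidable P" "decidable Q"
  shows "decidable (\<lambda>x. P x \<and> Q x)"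
proof -
  have "(if P x \<and> Q x then 1 else 0) = (if P x then 1 else 0::nat) * (if Q x then 1 else 0)" for x
    by auto
  then show ?thesis
    unfolding decidable_def by (simp only:) (intro computable_intros assms[unfolded decidable_def])
qed

lemma decidable_disj [computable_intros]:
  assumes "decidable P" "decidable Q"
  shows "decidable (\<lambda>x. P x \<or> Q x)"
  using decidable_not[OF decidable_conj[OF decidable_not[OF assms(1)] decidable_not[OF assms(2)]]]
  by (simp only: de_Morgan_conj not_not)

lemma decidable_imp [computable_intros]:
  assumes "decidable P" "decidable Q"
  shows "decidable (\<lambda>x. P x \<longrightarrow> Q x)"
  using decidable_disj[OF decidable_not[OF assms(1)] assms(2)] by (simp only: imp_conv_disj)

lemma decidable_iff [computable_intros]:
  assumes "decidable P" "decidable Q"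
  shows "decidable (\<lambda>x. P x \<longleftrightarrow> Q x)"
  using decidable_conj[OF decidable_imp[OF assms] decidable_imp[OF assms(2,1)]]
  by (simp only: iff_conv_conj_imp)

lemma decidable_le [computable_intros]:
  assumes "computable f" "computable g"
  shows "decidable (\<lambda>x. f x \<le> g x)"
  using decidable_not[OF decidable_less[OF assms(2,1)]] by (simp add: not_less)

lemma decidable_eq [computable_intros]:
  assumes "computable f" "computable g"
  shows "decidable (\<lambda>x. f x = g x)"
  using decidable_conj[OF decidable_le[OF assms] decidable_le[OF assms(2,1)]] by (simp only: order.eq_iff)

lemma computable_if [computable_intros]:
  assumes "decidable P" "computable f" "computable g"
  shows "computable (\<lambda>x. if P x then f x else g x)"
proof -
  have "(if P x then f x else g x) =
     (if P x then 1 else 0) * f x + (if \<not> P x then 1 else 0) * g x" for x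
    by auto
  then show ?thesis
    by (simp only:) (intro computable_intros assms[unfolded decidable_def]
        decidable_not[OF assms(1), unfolded decidable_def])
qed

lemma decidable_if [computable_intros]:
  assumes "decidable P" "decidable Q" "decidable R"
  shows "decidable (\<lambda>x. if P x then Q x else R x)"
proof -
  have eq: "(if P x then Q x else R x) = ((P x \<longrightarrow> Q x) \<and> (\<not> P x \<longrightarrow> R x))" for x
    by auto
  show ?thesis
    unfolding eq by (intro decidable_conj decidable_imp decidable_not assms)
qed

lemma decidable_ex_less [computable_intros]:
  assumes "computable b" "decidable (\<lambda>z. P (pfst z) (psnd z))"
  shows "decidable (\<lambda>x. \<exists>i<b x. P x i)"
proof -
  have eq: "(\<exists>i<b x. P x i) \<longleftrightarrow> (\<Sum>i<b x. if P x i then 1 else 0::nat) \<noteq> 0" for x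
    by (auto simp: sum_eq_0_iff)
  show ?thesis
    unfolding eq by (intro decidable_not decidable_eq computable_const computable_sum computable_if assms)
qed

lemma decidable_all_less [computable_intros]:
  assumes "computable b" "decidable (\<lambda>z. P (pfst z) (psnd z))"
  shows "decidable (\<lambda>x. \<forall>i<b x. P x i)"
proof -
  have eq: "(\<forall>i<b x. P x i) \<longleftrightarrow> \<not> (\<exists>i<b x. \<not> P x i)" for x
    by auto
  show ?thesis
    unfolding eq by (intro decidable_not decidable_ex_less assms)
qed

text \<open>The quotient counts the positive multiples of the divisor up to the dividend. For a
  nonzero divisor there are at most \<open>f x\<close> of them, so a bounded sum does the
  counting.\<close>

lemma computable_div [computable_intros]:
  assumes "computable f" "computable g"
  shows "computable (\<lambda>x. f x div g x)"
proof -
  have "f x div g x = (if g x = 0 then 0 else \<Sum>i<f x. if Suc i * g x \<le> f x then 1 else 0)" for x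
  proof (cases "g x = 0")
    case False
    have "(\<Sum>i<f x. if Suc i * g x \<le> f x then 1 else 0) = card {i. i < f x \<and> Suc i * g x \<le> f x}"
      by (simp flip: sum.inter_filter add: Collect_conj_eq lessThan_def)
    also have "{i. i < f x \<and> Suc i * g x \<le> f x} = {..<f x div g x}"
    proof -
      have "i < f x \<and> Suc i * g x \<le> f x \<longleftrightarrow> i < f x div g x" for i
        using False less_eq_div_iff_mult_less_eq[of "g x" "Suc i" "f x"]
          div_le_dividend[of "f x" "g x"] by linarith
      then show ?thesis by auto
    qed
    finally show ?thesis using False by simp
  qed simp
  then show ?thesis
    by (simp only:) (intro computable_intros assms computable_comp[OF assms(1)] computable_comp[OF assms(2)])
qed

lemma computable_mod [computable_intros]:
  assumes "computable f" "computable g"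
  shows "computable (\<lambda>x. f x mod g x)"
  unfolding modulo_nat_def by (intro computable_intros assms)

lemma decidable_even [computable_intros]:
  assumes "computable f"
  shows "decidable (\<lambda>x. even (f x))"
  unfolding even_iff_mod_2_eq_zero by (intro computable_intros assms)

lemma computable_min [computable_intros]:
  "computable f \<Longrightarrow> computable g \<Longrightarrow> computable (\<lambda>x. min (f x) (g x))"
  for f g :: "nat \<Rightarrow> nat"
  unfolding min_def by (intro computable_intros)

section \<open>Coded regions\<close>

definition dropc :: "nat \<Rightarrow> nat \<Rightarrow> nat" where
  "dropc j x = ((\<lambda>y. psnd (y - 1)) ^^ j) x"

definition nthc :: "nat \<Rightarrow> nat \<Rightarrow> nat" where
  "nthc x j = pfst (dropc j x - 1)"

text \<open>The length of a list is at most its code, so positions below \<open>x\<close> suffice.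
  The test for a nonzero rest excludes positions past the end, where \<open>nthc\<close> returns the
  default 0.\<close>

definition memc :: "nat \<Rightarrow> nat \<Rightarrow> bool" where
  "memc y x \<longleftrightarrow> (\<exists>j<x. dropc j x \<noteq> 0 \<and> nthc x j = y)"

text \<open>The empty list has code 0; by this fact and \<open>0 - 1 = 0\<close> its tail is again
  empty, so \<open>dropc\<close> can run past the end.\<close>

lemma psnd_zero: "psnd 0 = 0"
  using psnd_encode[of 0 0] by (simp add: prod_encode_def)

lemma dropc_list_encode: "dropc j (list_encode xs) = list_encode (drop j xs)"
proof (induction j arbitrary: xs)
  case (Suc j)
  have "psnd (list_encode xs - 1) = list_encode (tl xs)"
    by (cases xs) (simp_all add: psnd_zero)
  then show ?case
    using Suc[of "tl xs"] by (simp add: dropc_def funpow_Suc_right drop_Suc del: funpow.simps)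
qed (simp add: dropc_def)

lemma nthc_list_encode [simp]: "j < length xs \<Longrightarrow> nthc (list_encode xs) j = xs ! j"
  by (simp add: nthc_def dropc_list_encode flip: Cons_nth_drop_Suc)

lemma length_le_list_encode: "length xs \<le> list_encode xs"
  by (induction xs) (auto intro: order_trans le_prod_encode_2)

lemma less_list_encode: "y \<in> set xs \<Longrightarrow> y < list_encode xs"
proof (induction xs)
  case (Cons x xs)
  then show ?case
    using le_prod_encode_1[of x "list_encode xs"] le_prod_encode_2[of "list_encode xs" x] by auto
qed simp

lemma memc_list_encode [simp]: "memc y (list_encode xs) \<longleftrightarrow> y \<in> set xs"
proof -
  have "list_encode zs = 0 \<longleftrightarrow> zs = []" for zs
    by (cases zs) auto
  then have "memc y (list_encode xs) \<longleftrightarrow> (\<exists>j<list_encode xs. j < length xs \<and> xs ! j = y)"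
    by (auto simp: memc_def dropc_list_encode not_le)
  then show ?thesis
    using length_le_list_encode[of xs] by (force simp: in_set_conv_nth)
qed

declare list_encode.simps [simp del]

section \<open>States as strings of digits\<close>

definition digit :: "nat \<Rightarrow> nat \<Rightarrow> nat \<Rightarrow> nat" where
  "digit b s j = s div b ^ j mod b"

lemma ex_digits:
  assumes "\<And>j. j < m \<Longrightarrow> f j < b"
  shows "\<exists>s<b ^ m. \<forall>j<m. digit b s j = f j"
  using assms
proof (induction m arbitrary: f)
  case (Suc m)
  obtain s where s: "s < b ^ m" "\<And>j. j < m \<Longrightarrow> digit b s j = f (Suc j)"
    using Suc.IH[of "\<lambda>j. f (Suc j)"] Suc.prems by auto
  have f0: "f 0 < b" using Suc.prems by simp
  have "f 0 + b * s < b ^ Suc m"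
  proof -
    have "f 0 + b * s < b * Suc s" using f0 by simp
    also have "\<dots> \<le> b * b ^ m" using s(1) by (intro mult_le_mono2) simp
    finally show ?thesis by simp
  qed
  moreover have "digit b (f 0 + b * s) j = f j" if "j < Suc m" for j
  proof (cases j)
    case (Suc i)
    then have "digit b (f 0 + b * s) j = digit b s i"
      using f0 by (simp add: digit_def div_mult2_eq)
    then show ?thesis using s(2) Suc that by simp
  qed (use f0 in \<open>simp add: digit_def\<close>)
  ultimately show ?case by blast
qed simp

text \<open>
  \<open>ip\<close> is the integer part of a clock capped at \<open>K\<close>, and \<open>rk\<close> the rank of its fractional part.
  The ranks of the \<open>K + 1\<close> clocks, of 0, and of one threshold that locates a delay fit below \<open>K + 3\<close>.
\<close>
definition loc :: "nat \<Rightarrow> nat \<Rightarrow> nat" where "loc K s = digit (K + 3) s 0"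
definition ip :: "nat \<Rightarrow> nat \<Rightarrow> nat \<Rightarrow> nat" where "ip K s c = digit (K + 3) s (2 * c + 1)"
definition rk :: "nat \<Rightarrow> nat \<Rightarrow> nat \<Rightarrow> nat" where "rk K s c = digit (K + 3) s (2 * c + 2)"
text \<open>One digit for the location and two for each of the clocks \<open>0\<close> to
  \<open>K\<close>, where \<open>K\<close> will be the clock of absolute time.\<close>

definition nstates :: "nat \<Rightarrow> nat" where "nstates K = (K + 3) ^ (2 * K + 3)"

lemma rk_less: "rk K s c < K + 3"
  by (simp add: rk_def digit_def)

lemma ex_state:
  assumes "q < K + 3" "\<And>c. c \<le> K \<Longrightarrow> i c < K + 3" "\<And>c. c \<le> K \<Longrightarrow> r c < K + 3"
  obtains s where "s < nstates K" "loc K s = q" "\<And>c. c \<le> K \<Longrightarrow> ip K s c = i c" "\<And>c. c \<le> K \<Longrightarrow> rk K s c = r c"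
proof -
  define f where "f j = (if j = 0 then q else if odd j then i (j div 2) else r (j div 2 - 1))" for j
  have "f j < K + 3" if "j < 2 * K + 3" for j
  proof -
    have "j div 2 \<le> K" if "odd j" using that \<open>j < 2 * K + 3\<close> by presburger
    moreover have "j div 2 - 1 \<le> K" using \<open>j < 2 * K + 3\<close> by presburger
    ultimately show ?thesis using assms by (simp add: f_def)
  qed
  from ex_digits[of "2 * K + 3" f, OF this] obtain s where s: "s < nstates K"
    "\<And>j. j < 2 * K + 3 \<Longrightarrow> digit (K + 3) s j = f j"
    unfolding nstates_def by blast
  show thesis
  proof
    show "loc K s = q" by (simp add: loc_def s f_def)
    show "ip K s c = i c" "rk K s c = r c" if "c \<le> K" for c
      using that by (simp_all add: ip_def rk_def s f_def)
  qed (rule s)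
qed

text \<open>Finer than the usual clock regions: fractional parts are compared even for clocks beyond
  the cap, so that a delay acts on all clocks by the same rule. Only the order of the ranks and
  their vanishing are prescribed, hence one region has several codes.\<close>

definition in_region :: "nat \<Rightarrow> nat \<Rightarrow> (nat \<Rightarrow> real) \<Rightarrow> bool" where
  "in_region K s v \<longleftrightarrow>
     (\<forall>c\<le>K. ip K s c = min K (nat \<lfloor>v c\<rfloor>) \<and> (rk K s c = 0 \<longleftrightarrow> frac (v c) = 0)) \<and>
     (\<forall>c\<le>K. \<forall>d\<le>K. rk K s c < rk K s d \<longleftrightarrow> frac (v c) < frac (v d))"

definition asat :: "nat \<Rightarrow> nat \<Rightarrow> nat \<Rightarrow> bool" where
  "asat K s x \<longleftrightarrow>
     nthc x 1 = 0 \<and> ip K s (nthc x 0) < nthc x 2 \<or>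
     nthc x 1 = 1 \<and> (ip K s (nthc x 0) < nthc x 2 \<or> ip K s (nthc x 0) = nthc x 2 \<and> rk K s (nthc x 0) = 0) \<or>
     nthc x 1 = 2 \<and> ip K s (nthc x 0) = nthc x 2 \<and> rk K s (nthc x 0) = 0 \<or>
     nthc x 1 = 3 \<and> nthc x 2 \<le> ip K s (nthc x 0) \<or>
     nthc x 1 = 4 \<and> (nthc x 2 < ip K s (nthc x 0) \<or> ip K s (nthc x 0) = nthc x 2 \<and> rk K s (nthc x 0) \<noteq> 0)"

lemma asat_enc_atom_cases:
  "asat K s (enc_atom (c, r, n)) \<longleftrightarrow> (case r of
      Lt \<Rightarrow> ip K s c < n
    | Le \<Rightarrow> ip K s c < n \<or> ip K s c = n \<and> rk K s c = 0
    | Eq \<Rightarrow> ip K s c = n \<and> rk K s c = 0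
    | Ge \<Rightarrow> n \<le> ip K s c
    | Gt \<Rightarrow> n < ip K s c \<or> ip K s c = n \<and> rk K s c \<noteq> 0)"
  by (cases r) (simp_all add: asat_def enc_atom_def)

lemma nat_floor_frac: "0 \<le> x \<Longrightarrow> x = real (nat \<lfloor>x\<rfloor>) + frac x"
  by (simp add: frac_def)

text \<open>An integer bound cannot separate two values strictly between the same consecutive
  integers, so the integer part and the vanishing of the fraction decide every comparison.\<close>

lemma cmp_sat_region:
  assumes "0 \<le> f" "f < 1"
  shows "cmp_sat r (real m + f) (real n) \<longleftrightarrow> (case r of
      Lt \<Rightarrow> m < n
    | Le \<Rightarrow> m < n \<or> m = n \<and> f = 0
    | Eq \<Rightarrow> m = n \<and> f = 0
    | Ge \<Rightarrow> n \<le> m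
    | Gt \<Rightarrow> n < m \<or> m = n \<and> f \<noteq> 0)"
proof -
  consider "real m + 1 \<le> real n" | "m = n" | "real n + 1 \<le> real m"
    by (cases m n rule: linorder_cases) linarith+
  then show ?thesis
    by cases (use assms in \<open>cases r; force\<close>)+
qed

text \<open>Capping loses nothing because \<open>n < K\<close>: a clock value of at least
  \<open>K\<close> exceeds \<open>n\<close> strictly, and so does its capped integer part.\<close>

lemma asat_enc_atom:
  assumes "in_region K s v" "c \<le> K" "n < K" "0 \<le> v c"
  shows "asat K s (enc_atom (c, r, n)) \<longleftrightarrow> cmp_sat r (v c) (real n)"
proof -
  have "ip K s c = min K (nat \<lfloor>v c\<rfloor>)" "rk K s c = 0 \<longleftrightarrow> frac (v c) = 0"
    using assms(1,2) by (auto simp: in_region_def)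
  then have "asat K s (enc_atom (c, r, n)) \<longleftrightarrow> cmp_sat r (real (nat \<lfloor>v c\<rfloor>) + frac (v c)) (real n)"
    using assms(3) by (subst cmp_sat_region) (auto simp: asat_enc_atom_cases frac_lt_1 split: cmp.splits)
  with nat_floor_frac[OF assms(4)] show ?thesis by simp
qed

text \<open>
  Ranks in use need not be consecutive. A rerank step respaces them, which makes room for the
  cyclic shift of all ranks by one (\<open>unit_delay\<close> below) to pass between any two fractional parts.
\<close>
definition rerank :: "nat \<Rightarrow> nat \<Rightarrow> nat \<Rightarrow> bool" where
  "rerank K s s' \<longleftrightarrow> loc K s' = loc K s \<and>
     (\<forall>c<Suc K. ip K s' c = ip K s c \<and> (rk K s' c = 0 \<longleftrightarrow> rk K s c = 0) \<and>
        (\<forall>d<Suc K. rk K s' c < rk K s' d \<longleftrightarrow> rk K s c < rk K s d))"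

lemma in_region_rerank:
  "in_region K s v \<Longrightarrow> in_region K s' v \<Longrightarrow> loc K s = loc K s' \<Longrightarrow> rerank K s s'"
  by (simp add: in_region_def rerank_def)

section \<open>Ranks of fractional parts under delays\<close>

lemma rank_properties:
  fixes F :: "real set"
  assumes "finite F" "0 \<in> F" "\<forall>x\<in>F. 0 \<le> x"
  defines "rank \<equiv> \<lambda>x. card {y \<in> F. y < x}"
  shows "x \<in> F \<Longrightarrow> y \<in> F \<Longrightarrow> rank x < rank y \<longleftrightarrow> x < y"
    and "x \<in> F \<Longrightarrow> rank x = 0 \<longleftrightarrow> x = 0"
    and "x \<in> F \<Longrightarrow> rank x < card F"
proof -
  have less: "rank x < rank y" if "x \<in> F" "x < y" for x y
    unfolding rank_def by (rule psubset_card_mono) (use that assms(1) in auto)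
  show "x \<in> F \<Longrightarrow> y \<in> F \<Longrightarrow> rank x < rank y \<longleftrightarrow> x < y"
    using less by (metis less_asym' linorder_less_linear order_less_irrefl)
  show "x \<in> F \<Longrightarrow> rank x = 0 \<longleftrightarrow> x = 0"
    using assms(1-3) by (force simp: rank_def)
  show "x \<in> F \<Longrightarrow> rank x < card F"
    unfolding rank_def by (rule psubset_card_mono) (use assms(1) in auto)
qed

lemma frac_add_no_carry:
  assumes "frac x < 1 - d" "0 \<le> d" "d < (1::real)"
  shows "\<lfloor>x + d\<rfloor> = \<lfloor>x\<rfloor>" "frac (x + d) = frac x + d"
proof -
  show "\<lfloor>x + d\<rfloor> = \<lfloor>x\<rfloor>"
    by (rule floor_unique) (use assms in \<open>unfold frac_def, linarith+\<close>)
  then show "frac (x + d) = frac x + d"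
    by (simp add: frac_def)
qed

lemma frac_add_carry:
  assumes "1 - d \<le> frac x" "0 \<le> d" "d < (1::real)"
  shows "\<lfloor>x + d\<rfloor> = \<lfloor>x\<rfloor> + 1" "frac (x + d) = frac x - (1 - d)"
proof -
  show "\<lfloor>x + d\<rfloor> = \<lfloor>x\<rfloor> + 1"
    by (rule floor_unique) (use assms frac_lt_1[of x] in \<open>unfold frac_def, linarith+\<close>)
  then show "frac (x + d) = frac x - (1 - d)"
    by (simp add: frac_def)
qed

text \<open>
  The threshold \<open>e\<close> will be \<open>1 - d\<close>: a delay of \<open>d\<close> carries exactly the clocks whose fractional
  part is at least \<open>e\<close> across an integer.
\<close>
lemma ex_ranked_state:
  assumes v: "\<And>c. c \<le> K \<Longrightarrow> 0 \<le> v c" and q: "q < K + 3" and e: "0 < e" "e < 1"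
  obtains s p where "s < nstates K" "loc K s = q" "in_region K s v" "0 < p" "p < K + 3"
    and "\<And>c. c \<le> K \<Longrightarrow> rk K s c < p \<longleftrightarrow> frac (v c) < e"
    and "\<And>c. c \<le> K \<Longrightarrow> rk K s c = p \<longleftrightarrow> frac (v c) = e"
proof -
  \<comment> \<open>Including 0 gives rank 0 to integral clocks only; including \<open>e\<close>
    reserves a rank for the threshold even when no clock has that fractional part.\<close>
  define F where "F = insert 0 (insert e ((\<lambda>c. frac (v c)) ` {..K}))"
  define rank where "rank x = card {y \<in> F. y < x}" for x
  have F: "finite F" "0 \<in> F" "\<forall>x\<in>F. 0 \<le> x" "e \<in> F"
    "\<And>c. c \<le> K \<Longrightarrow> frac (v c) \<in> F"
    using e by (auto simp: F_def)
  have "card F \<le> Suc (Suc (card ((\<lambda>c. frac (v c)) ` {..K})))"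
    unfolding F_def by (intro order_trans[OF card_insert_le_m1] card_insert_le_m1) simp_all
  also have "\<dots> \<le> K + 3"
    using card_image_le[of "{..K}" "\<lambda>c. frac (v c)"] by simp
  finally have cF: "card F \<le> K + 3" .
  note rank = rank_properties[OF F(1-3), folded rank_def]
  have rank_less: "rank x < K + 3" if "x \<in> F" for x
    using rank(3)[OF that] cF by linarith
  have rank_eq: "rank x = rank y \<longleftrightarrow> x = y" if "x \<in> F" "y \<in> F" for x y
    using rank(1)[OF that] rank(1)[OF that(2,1)] by (metis linorder_neqE less_irrefl)
  obtain s where s: "s < nstates K" "loc K s = q"
    "\<And>c. c \<le> K \<Longrightarrow> ip K s c = min K (nat \<lfloor>v c\<rfloor>)" "\<And>c. c \<le> K \<Longrightarrow> rk K s c = rank (frac (v c))"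
    by (rule ex_state[OF q, of "\<lambda>c. min K (nat \<lfloor>v c\<rfloor>)" "\<lambda>c. rank (frac (v c))"])
      (auto simp: F rank_less)
  show thesis
  proof (rule that[of s "rank e"])
    show "in_region K s v"
      unfolding in_region_def using s rank(1,2) F(5) by simp
    show "0 < rank e"
      using rank(2)[OF F(4)] e by auto
  qed (use s rank(1) rank_eq rank_less F in simp_all)
qed

text \<open>The rotation of the ranks that takes \<open>p\<close> to 0. Quotient and remainder tell
  which ranks wrap around and where they land, just as floor and fraction do for
  \<open>x + d\<close> with threshold \<open>1 - d\<close>.\<close>

lemma add_mod_cyclic:
  assumes "r < D" "0 < p" "p < (D::nat)"
  shows "(r + (D - p)) div D = (if r < p then 0 else 1)"
    and "(r + (D - p)) mod D = (if r < p then r + (D - p) else r - p)"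
proof -
  have "(r + (D - p)) div D = (if r < p then 0 else 1) \<and>
      (r + (D - p)) mod D = (if r < p then r + (D - p) else r - p)"
  proof (cases "r < p")
    case True
    then have "r + (D - p) < D" using assms by linarith
    with True show ?thesis by simp
  next
    case False
    then have eq: "r + (D - p) = (r - p) + D" and "r - p < D" using assms by linarith+
    have "(u + D) div D = 1 \<and> (u + D) mod D = u" if "u < D" for u
      using that by simp
    from this[OF \<open>r - p < D\<close>] show ?thesis
      using False unfolding eq by simp
  qed
  then show "(r + (D - p)) div D = (if r < p then 0 else 1)"
    "(r + (D - p)) mod D = (if r < p then r + (D - p) else r - p)"
    by blast+
qed

text \<open>A delay \<open>d < 1\<close> rotates the circle of fractional parts so that
  \<open>1 - d\<close> arrives at 0; on ranks this is the rotation taking the rank of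
  \<open>1 - d\<close> to 0, and wrapping around is the carry into the integer part. The code
  \<open>s\<close> has to be chosen with \<open>d\<close> in mind, since the threshold needs a rank
  of its own.\<close>

lemma ex_region_delay:
  assumes v: "\<And>c. c \<le> K \<Longrightarrow> 0 \<le> v c" and q: "q < K + 3" and d: "0 < d" "d < 1"
  obtains s k where "s < nstates K" "loc K s = q" "in_region K s v"
    and "\<And>c. c \<le> K \<Longrightarrow> nat \<lfloor>v c + d\<rfloor> = nat \<lfloor>v c\<rfloor> + (rk K s c + k) div (K + 3)"
    and "\<And>c. c \<le> K \<Longrightarrow> (rk K s c + k) mod (K + 3) = 0 \<longleftrightarrow> frac (v c + d) = 0"
    and "\<And>c e. c \<le> K \<Longrightarrow> e \<le> K \<Longrightarrow>
      (rk K s c + k) mod (K + 3) < (rk K s e + k) mod (K + 3) \<longleftrightarrow> frac (v c + d) < frac (v e + d)"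
proof -
  obtain s p where s: "s < nstates K" "loc K s = q" "in_region K s v" and p: "0 < p" "p < K + 3"
    and less: "\<And>c. c \<le> K \<Longrightarrow> rk K s c < p \<longleftrightarrow> frac (v c) < 1 - d"
    and eq: "\<And>c. c \<le> K \<Longrightarrow> rk K s c = p \<longleftrightarrow> frac (v c) = 1 - d"
    using ex_ranked_state[of K v q "1 - d"] v q d by auto
  note cyc = add_mod_cyclic[OF rk_less p]
  have fr: "frac (v c + d) = (if frac (v c) < 1 - d then frac (v c) + d else frac (v c) - (1 - d))" for c
    using frac_add_no_carry(2)[of "v c" d] frac_add_carry(2)[of d "v c"] d by auto
  show thesis
  proof (rule that[of s "K + 3 - p"])
    show "nat \<lfloor>v c + d\<rfloor> = nat \<lfloor>v c\<rfloor> + (rk K s c + (K + 3 - p)) div (K + 3)" if "c \<le> K" for c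
      using frac_add_no_carry(1)[of "v c" d] frac_add_carry(1)[of d "v c"] d less[OF that] v[OF that]
      unfolding cyc by (auto simp: nat_add_distrib)
    show "(rk K s c + (K + 3 - p)) mod (K + 3) = 0 \<longleftrightarrow> frac (v c + d) = 0" if "c \<le> K" for c
    proof (cases "rk K s c < p")
      case True
      then have "frac (v c + d) \<noteq> 0"
        using less[OF that] add_nonneg_pos[OF frac_ge_0[of "v c"] d(1)] unfolding fr by simp
      with True p show ?thesis unfolding cyc by simp
    next
      case False
      then show ?thesis
        using less[OF that] eq[OF that] unfolding fr cyc by auto
    qed
    show "(rk K s c + (K + 3 - p)) mod (K + 3) < (rk K s e + (K + 3 - p)) mod (K + 3)
        \<longleftrightarrow> frac (v c + d) < frac (v e + d)" if "c \<le> K" "e \<le> K" for c e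
    proof -
      have ce: "rk K s c < rk K s e \<longleftrightarrow> frac (v c) < frac (v e)"
        using that s(3) by (simp add: in_region_def)
      have b: "frac (v c) < 1" "frac (v e) < 1" "0 \<le> frac (v c)" "0 \<le> frac (v e)"
        by (simp_all add: frac_lt_1)
      show ?thesis
      \<comment> \<open>A clock that crosses an integer ends with fraction below \<open>d\<close>,
        any other one at \<open>d\<close> or above, so the order in mixed cases is determined;
        otherwise it is inherited.\<close>
      proof (cases "rk K s c < p"; cases "rk K s e < p")
        assume "rk K s c < p" "rk K s e < p"
        then show ?thesis using less that ce unfolding cyc fr by simp
      next
        assume a: "rk K s c < p" "\<not> rk K s e < p"
        then have "frac (v c) < 1 - d" "\<not> frac (v e) < 1 - d" using less that by simp_all
        then have "\<not> frac (v c + d) < frac (v e + d)" using b unfolding fr by (smt (verit))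
        then show ?thesis using a p rk_less[of K s e] unfolding cyc by simp
      next
        assume a: "\<not> rk K s c < p" "rk K s e < p"
        then have "\<not> frac (v c) < 1 - d" "frac (v e) < 1 - d" using less that by simp_all
        then have "frac (v c + d) < frac (v e + d)" using b unfolding fr by (smt (verit))
        then show ?thesis using a p rk_less[of K s c] unfolding cyc by simp
      next
        assume a: "\<not> rk K s c < p" "\<not> rk K s e < p"
        then have "rk K s c - p < rk K s e - p \<longleftrightarrow> rk K s c < rk K s e" by linarith
        then show ?thesis using a less that ce unfolding cyc fr by simp
      qed
    qed
  qed (use s in auto)
qed

section \<open>The region graph\<close>

text \<open>Edges and atoms stay coded and are addressed by position: an edge has source, action,
  guard, resets and target at positions 0 to 4. Elements are smaller than the code of their list, so
  the bounded quantifier reaches every atom of the guard.\<close>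

definition enabled :: "nat \<Rightarrow> nat \<Rightarrow> nat \<Rightarrow> bool" where
  "enabled a s e \<longleftrightarrow> memc e (nthc a 4) \<and> loc a s = nthc e 0 \<and>
     (\<forall>x<nthc e 2. memc x (nthc e 2) \<longrightarrow> asat a s x)"

definition silent_step :: "nat \<Rightarrow> nat \<Rightarrow> nat \<Rightarrow> bool" where
  "silent_step a s s' \<longleftrightarrow> (\<exists>e<a. enabled a s e \<and> nthc e 1 = 0 \<and> loc a s' = nthc e 4 \<and>
     (\<forall>c<Suc a. if memc c (nthc e 3) then ip a s' c = 0 \<and> rk a s' c = 0
        else ip a s' c = ip a s c \<and> rk a s' c = rk a s c))"

definition emits :: "nat \<Rightarrow> nat \<Rightarrow> nat \<Rightarrow> bool" where
  "emits a s l \<longleftrightarrow> (\<exists>e<a. enabled a s e \<and> nthc e 1 = Suc l)"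

text \<open>One step of the rotation modulo \<open>a + 3\<close>, whose largest rank is
  \<open>a + 2\<close>. Its duration is not fixed: if \<open>h r\<close> is the fractional part
  realizing rank \<open>r\<close> after the step, it lasts \<open>h 1\<close>.\<close>

definition unit_delay :: "nat \<Rightarrow> nat \<Rightarrow> nat \<Rightarrow> bool" where
  "unit_delay a s s' \<longleftrightarrow> loc a s' = loc a s \<and>
     (\<forall>c<Suc a. if rk a s c = a + 2 then rk a s' c = 0 \<and> ip a s' c = min a (Suc (ip a s c))
        else rk a s' c = Suc (rk a s c) \<and> ip a s' c = ip a s c)"

definition initial :: "nat \<Rightarrow> nat \<Rightarrow> bool" where
  "initial a s \<longleftrightarrow> loc a s = nthc a 1 \<and> (\<forall>c<Suc a. ip a s c = 0 \<and> rk a s c = 0)"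

definition stay :: "nat \<Rightarrow> nat \<Rightarrow> nat \<Rightarrow> bool" where
  "stay a s s' \<longleftrightarrow> silent_step a s s' \<or> rerank a s s' \<or> unit_delay a s s' \<and> rk a s a \<noteq> a + 2"

definition tick :: "nat \<Rightarrow> nat \<Rightarrow> nat \<Rightarrow> bool" where
  "tick a s s' \<longleftrightarrow> unit_delay a s s' \<and> rk a s a = a + 2"

inductive areach :: "nat \<Rightarrow> nat \<Rightarrow> nat \<Rightarrow> bool" for a where
  initial: "s < nstates a \<Longrightarrow> initial a s \<Longrightarrow> areach a 0 s"
| stay: "areach a n s \<Longrightarrow> s' < nstates a \<Longrightarrow> stay a s s' \<Longrightarrow> areach a n s'"
| tick: "areach a n s \<Longrightarrow> s' < nstates a \<Longrightarrow> tick a s s' \<Longrightarrow> areach a (Suc n) s'"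

lemma areach_less: "areach a n s \<Longrightarrow> s < nstates a"
  by (induction rule: areach.induct) auto

section \<open>Decoding the code of an automaton\<close>

lemma nthc_enc_enta [simp]:
  "nthc (enc_enta A) 1 = init A"
  "nthc (enc_enta A) (Suc 0) = init A"
  "nthc (enc_enta A) 4 = list_encode (map enc_edge (edges A))"
  by (simp_all add: enc_enta_def)

lemma nthc_enc_edge [simp]:
  "nthc (enc_edge (q, b, g, R, q')) 0 = q"
  "nthc (enc_edge (q, b, g, R, q')) 1 = enc_act b"
  "nthc (enc_edge (q, b, g, R, q')) (Suc 0) = enc_act b"
  "nthc (enc_edge (q, b, g, R, q')) 2 = list_encode (map enc_atom g)"
  "nthc (enc_edge (q, b, g, R, q')) 3 = list_encode R"
  "nthc (enc_edge (q, b, g, R, q')) 4 = q'"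
  by (simp_all add: enc_edge_def)

lemma init_less: "init A < enc_enta A"
  unfolding enc_enta_def by (rule less_list_encode) simp

lemma edge_less:
  assumes "(q, b, g, R, q') \<in> set (edges A)"
  shows "enc_edge (q, b, g, R, q') < enc_enta A"
    and "q < enc_enta A" "q' < enc_enta A" "enc_act b < enc_enta A"
    and "c \<in> set R \<Longrightarrow> c < enc_enta A"
    and "(c, r, n) \<in> set g \<Longrightarrow> c < enc_enta A \<and> n < enc_enta A"
proof -
  have "enc_edge (q, b, g, R, q') < list_encode (map enc_edge (edges A))"
    using assms by (force intro: less_list_encode)
  also have "\<dots> < enc_enta A"
    unfolding enc_enta_def by (rule less_list_encode) simp
  finally show e: "enc_edge (q, b, g, R, q') < enc_enta A" .
  have less: "x < enc_enta A" if "x \<in> {q, enc_act b, list_encode (map enc_atom g), list_encode R, q'}" for x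
    using that less_list_encode[of x "[q, enc_act b, list_encode (map enc_atom g), list_encode R, q']"] e
    by (auto simp: enc_edge_def)
  from less show "q < enc_enta A" "q' < enc_enta A" "enc_act b < enc_enta A"
    by simp_all
  from less have R: "list_encode R < enc_enta A" and g: "list_encode (map enc_atom g) < enc_enta A"
    by simp_all
  show "c \<in> set R \<Longrightarrow> c < enc_enta A"
    using R less_list_encode[of c R] by simp
  show "c < enc_enta A \<and> n < enc_enta A" if "(c, r, n) \<in> set g"
  proof -
    have "enc_atom (c, r, n) < list_encode (map enc_atom g)"
      using that by (force intro: less_list_encode)
    moreover have "c < enc_atom (c, r, n)" "n < enc_atom (c, r, n)"
      unfolding enc_atom_def by (auto intro!: less_list_encode)
    ultimately show ?thesis using g by linarith
  qed
qed

lemma enabled_enc_enta: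
  assumes "in_region (enc_enta A) s v" "\<And>c. 0 \<le> v c"
  shows "enabled (enc_enta A) s e \<longleftrightarrow> (\<exists>q b g R q'. (q, b, g, R, q') \<in> set (edges A) \<and>
     e = enc_edge (q, b, g, R, q') \<and> loc (enc_enta A) s = q \<and> guard_sat g v)"
proof -
  have sat: "(\<forall>x<list_encode (map enc_atom g). memc x (list_encode (map enc_atom g)) \<longrightarrow> asat (enc_enta A) s x)
      \<longleftrightarrow> guard_sat g v" if "(q, b, g, R, q') \<in> set (edges A)" for q b g R q'
  proof -
    have "(\<forall>x<list_encode (map enc_atom g). memc x (list_encode (map enc_atom g)) \<longrightarrow> asat (enc_enta A) s x)
      \<longleftrightarrow> (\<forall>x\<in>set g. asat (enc_enta A) s (enc_atom x))"
      using less_list_encode[of _ "map enc_atom g"] by auto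
    also have "\<dots> \<longleftrightarrow> guard_sat g v"
      unfolding guard_sat_def
    proof (rule ball_cong[OF refl], clarify)
      fix c r n assume "(c, r, n) \<in> set g"
      from edge_less(6)[OF that this] show "asat (enc_enta A) s (enc_atom (c, r, n)) \<longleftrightarrow> cmp_sat r (v c) (real n)"
        by (intro asat_enc_atom[OF assms(1)]) (auto simp: assms(2))
    qed
    finally show ?thesis .
  qed
  show ?thesis
  proof
    assume e: "enabled (enc_enta A) s e"
    then obtain x where x: "x \<in> set (edges A)" "e = enc_edge x"
      by (auto simp: enabled_def)
    obtain q b g R q' where "x = (q, b, g, R, q')" by (rule prod_cases5)
    with x e sat[of q b g R q'] show "\<exists>q b g R q'. (q, b, g, R, q') \<in> set (edges A) \<and>
     e = enc_edge (q, b, g, R, q') \<and> loc (enc_enta A) s = q \<and> guard_sat g v"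
      by (auto simp: enabled_def)
  next
    assume "\<exists>q b g R q'. (q, b, g, R, q') \<in> set (edges A) \<and>
     e = enc_edge (q, b, g, R, q') \<and> loc (enc_enta A) s = q \<and> guard_sat g v"
    then obtain q b g R q' where "(q, b, g, R, q') \<in> set (edges A)" "e = enc_edge (q, b, g, R, q')"
      "loc (enc_enta A) s = q" "guard_sat g v" by blast
    with sat show "enabled (enc_enta A) s e"
      by (auto simp: enabled_def)
  qed
qed

lemma emits_enc_enta:
  assumes "in_region (enc_enta A) s v" "\<And>c. 0 \<le> v c"
  shows "emits (enc_enta A) s l \<longleftrightarrow> (\<exists>g R q'. (loc (enc_enta A) s, Some l, g, R, q') \<in> set (edges A) \<and> guard_sat g v)"
proof
  assume "emits (enc_enta A) s l"
  then obtain q b g R q' where "(q, b, g, R, q') \<in> set (edges A)" "loc (enc_enta A) s = q"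
    "guard_sat g v" "enc_act b = Suc l"
    unfolding emits_def enabled_enc_enta[OF assms] by auto
  moreover from this have "b = Some l" by (auto simp: enc_act_def split: option.splits)
  ultimately show "\<exists>g R q'. (loc (enc_enta A) s, Some l, g, R, q') \<in> set (edges A) \<and> guard_sat g v"
    by blast
next
  assume "\<exists>g R q'. (loc (enc_enta A) s, Some l, g, R, q') \<in> set (edges A) \<and> guard_sat g v"
  then obtain g R q' where e: "(loc (enc_enta A) s, Some l, g, R, q') \<in> set (edges A)" "guard_sat g v"
    by blast
  have "enabled (enc_enta A) s (enc_edge (loc (enc_enta A) s, Some l, g, R, q'))"
    unfolding enabled_enc_enta[OF assms] using e by blast
  with edge_less(1)[OF e(1)] show "emits (enc_enta A) s l"
    unfolding emits_def by (auto simp: enc_act_def)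
qed

section \<open>Completeness of the region graph\<close>

lemma reach_invariant:
  assumes "reach A q v t w"
  shows "0 \<le> v c" "0 \<le> t" "enc_enta A \<le> c \<Longrightarrow> v c = t" "q < enc_enta A"
proof -
  have "(\<forall>c. 0 \<le> v c) \<and> 0 \<le> t \<and> (\<forall>c. enc_enta A \<le> c \<longrightarrow> v c = t) \<and> q < enc_enta A"
    using assms
  proof (induction rule: reach.induct)
    case (step q v t w b g R q')
    then show ?case using edge_less(3,5)[OF step.hyps(2)] by (auto simp: not_less[symmetric])
  qed (auto simp: init_less)
  then show "0 \<le> v c" "0 \<le> t" "enc_enta A \<le> c \<Longrightarrow> v c = t" "q < enc_enta A"
    by blast+
qed

text \<open>Comes from iterating \<open>unit_delay\<close>:
  \<open>(rk a s c + k) div (a + 3)\<close> counts how often clock \<open>c\<close> wraps, and for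
  \<open>c = a\<close> this is the number of ticks. A digit can exceed the cap \<open>a\<close>; the
  hypothesis on \<open>ip\<close> makes the formula true for \<open>k = 0\<close>.\<close>

lemma areach_delay:
  assumes "areach a n s" "\<And>c. c \<le> a \<Longrightarrow> ip a s c \<le> a"
  shows "\<exists>s'. areach a (n + (rk a s a + k) div (a + 3)) s' \<and> loc a s' = loc a s \<and>
    (\<forall>c\<le>a. ip a s' c = min a (ip a s c + (rk a s c + k) div (a + 3)) \<and>
       rk a s' c = (rk a s c + k) mod (a + 3))"
proof (induction k)
  case 0
  then show ?case
    using assms rk_less[of a s] by (intro exI[of _ s]) (auto simp: min_absorb2)
next
  case (Suc k)
  then obtain s1 where s1: "areach a (n + (rk a s a + k) div (a + 3)) s1" "loc a s1 = loc a s"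
    "\<And>c. c \<le> a \<Longrightarrow> ip a s1 c = min a (ip a s c + (rk a s c + k) div (a + 3))"
    "\<And>c. c \<le> a \<Longrightarrow> rk a s1 c = (rk a s c + k) mod (a + 3)"
    by blast
  have divmod: "Suc x div (a + 3) = x div (a + 3) + (if x mod (a + 3) = a + 2 then 1 else 0)"
    "Suc x mod (a + 3) = (if x mod (a + 3) = a + 2 then 0 else Suc (x mod (a + 3)))" for x
    by (auto simp: div_Suc mod_Suc)
  have "loc a s < a + 3" by (simp add: loc_def digit_def)
  then obtain s2 where s2: "s2 < nstates a" "loc a s2 = loc a s"
    "\<And>c. c \<le> a \<Longrightarrow> ip a s2 c = min a (ip a s c + (rk a s c + Suc k) div (a + 3))"
    "\<And>c. c \<le> a \<Longrightarrow> rk a s2 c = (rk a s c + Suc k) mod (a + 3)"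
    by (rule ex_state[where K = a and i = "\<lambda>c. min a (ip a s c + (rk a s c + Suc k) div (a + 3))"
        and r = "\<lambda>c. (rk a s c + Suc k) mod (a + 3)"]) (auto simp: min_less_iff_disj)
  have u: "unit_delay a s1 s2"
    unfolding unit_delay_def less_Suc_eq_le
  proof (intro conjI allI impI)
    show "loc a s2 = loc a s1" using s1(2) s2(2) by simp
    show "if rk a s1 c = a + 2 then rk a s2 c = 0 \<and> ip a s2 c = min a (Suc (ip a s1 c))
        else rk a s2 c = Suc (rk a s1 c) \<and> ip a s2 c = ip a s1 c" if "c \<le> a" for c
      unfolding s1(3,4)[OF that] s2(3,4)[OF that] add_Suc_right divmod by auto
  qed
  have "areach a (n + (rk a s a + Suc k) div (a + 3)) s2"
  proof (cases "rk a s1 a = a + 2")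
    case True
    with u have "tick a s1 s2" by (simp add: tick_def)
    from areach.tick[OF s1(1) s2(1) this] True show ?thesis
      using s1(4)[of a] unfolding add_Suc_right divmod by simp
  next
    case False
    with u have "stay a s1 s2" by (simp add: stay_def)
    from areach.stay[OF s1(1) s2(1) this] False show ?thesis
      using s1(4)[of a] unfolding add_Suc_right divmod by simp
  qed
  with s2 show ?case by blast
qed

text \<open>All codes of the region are required at once, because the code needed for a following
  delay depends on the length of that delay. By \<open>rerank\<close> steps this is no more than
  reaching a single code. Clock \<open>a\<close> shows absolute time, so its floor is the counter
  value.\<close>

definition complete_at :: "nat \<Rightarrow> nat \<Rightarrow> (nat \<Rightarrow> real) \<Rightarrow> bool" where
  "complete_at a q v \<longleftrightarrow>
     (\<forall>s<nstates a. loc a s = q \<longrightarrow> in_region a s v \<longrightarrow> areach a (nat \<lfloor>v a\<rfloor>) s)"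

lemma complete_at_rerank:
  assumes "areach a (nat \<lfloor>v a\<rfloor>) s" "loc a s = q" "in_region a s v"
  shows "complete_at a q v"
  unfolding complete_at_def
proof (intro allI impI)
  fix s' assume "s' < nstates a" "loc a s' = q" "in_region a s' v"
  with in_region_rerank[OF assms(3) this(3)] assms(2) have "stay a s s'"
    by (simp add: stay_def)
  with assms(1) \<open>s' < nstates a\<close> show "areach a (nat \<lfloor>v a\<rfloor>) s'"
    by (rule areach.stay)
qed

lemma complete_at_small_delay:
  assumes "complete_at a q v" "q < a + 3" "\<And>c. 0 \<le> v c" "0 < d" "d < 1"
  shows "complete_at a q (\<lambda>c. v c + d)"
proof -
  obtain s k where s: "s < nstates a" "loc a s = q" "in_region a s v"
    and fl: "\<And>c. c \<le> a \<Longrightarrow> nat \<lfloor>v c + d\<rfloor> = nat \<lfloor>v c\<rfloor> + (rk a s c + k) div (a + 3)"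
    and z: "\<And>c. c \<le> a \<Longrightarrow> (rk a s c + k) mod (a + 3) = 0 \<longleftrightarrow> frac (v c + d) = 0"
    and o: "\<And>c e. c \<le> a \<Longrightarrow> e \<le> a \<Longrightarrow>
      (rk a s c + k) mod (a + 3) < (rk a s e + k) mod (a + 3) \<longleftrightarrow> frac (v c + d) < frac (v e + d)"
    using ex_region_delay[of a v q d] assms(2-5) by metis
  have ip: "ip a s c = min a (nat \<lfloor>v c\<rfloor>)" if "c \<le> a" for c
    using s(3) that by (simp add: in_region_def)
  have ip_le: "ip a s c \<le> a" if "c \<le> a" for c
    using ip[OF that] by simp
  have "areach a (nat \<lfloor>v a\<rfloor>) s"
    using assms(1) s by (simp add: complete_at_def)
  from areach_delay[OF this ip_le, of k] s(2) obtain s' where s': "areach a (nat \<lfloor>v a\<rfloor> + (rk a s a + k) div (a + 3)) s'" "loc a s' = q"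
    "\<And>c. c \<le> a \<Longrightarrow> ip a s' c = min a (ip a s c + (rk a s c + k) div (a + 3))"
    "\<And>c. c \<le> a \<Longrightarrow> rk a s' c = (rk a s c + k) mod (a + 3)"
    by blast
  show ?thesis
  proof (rule complete_at_rerank)
    show "areach a (nat \<lfloor>v a + d\<rfloor>) s'" using s'(1) fl[of a] by simp
    show "in_region a s' (\<lambda>c. v c + d)"
      unfolding in_region_def using s'(3,4) z o by (auto simp: ip fl)
  qed (rule s')
qed

lemma complete_at_delay:
  assumes "complete_at a q v" "q < a + 3" "\<And>c. 0 \<le> v c" "0 \<le> d"
  shows "complete_at a q (\<lambda>c. v c + d)"
proof -
  \<comment> \<open>Slices of length at most 1/2 stay below the bound 1 of
    \<open>complete_at_small_delay\<close>, and induction on their number covers every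
    delay.\<close>
  have "\<forall>d. 0 \<le> d \<longrightarrow> d \<le> real n / 2 \<longrightarrow> complete_at a q (\<lambda>c. v c + d)" for n
  proof (induction n)
    case 0
    then show ?case using assms(1) by simp
  next
    case (Suc n)
    show ?case
    proof (intro allI impI)
      fix d :: real assume d: "0 \<le> d" "d \<le> real (Suc n) / 2"
      define e where "e = max 0 (d - 1/2)"
      have e: "0 \<le> e" "e \<le> real n / 2" "d - e < 1" "e \<le> d"
        using d by (auto simp: e_def max_def)
      have c: "complete_at a q (\<lambda>c. v c + e)" using Suc e by blast
      show "complete_at a q (\<lambda>c. v c + d)"
      proof (cases "e = d")
        case False
        then have "complete_at a q (\<lambda>c. (v c + e) + (d - e))"
          by (intro complete_at_small_delay[OF c]) (use assms(2,3) e in auto)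
        then show ?thesis by simp
      qed (use c in simp)
    qed
  qed
  moreover obtain n where "2 * d \<le> real n"
    using real_arch_simple by blast
  ultimately show ?thesis using assms(4) by (metis le_divide_eq_numeral1(1) mult.commute)
qed

lemma reach_complete:
  assumes "reach A q v t w" "w = []"
  shows "complete_at (enc_enta A) q v"
  using assms
proof (induction rule: reach.induct)
  case start
  show ?case
    unfolding complete_at_def
  proof (intro allI impI)
    fix s assume s: "s < nstates (enc_enta A)" "loc (enc_enta A) s = init A" "in_region (enc_enta A) s (\<lambda>_. 0)"
    then have "initial (enc_enta A) s"
      by (auto simp: initial_def in_region_def)
    with s(1) show "areach (enc_enta A) (nat \<lfloor>0::real\<rfloor>) s"
      by (simp add: areach.initial)
  qed
next
  case (delay q v t w d)
  show ?case
    by (rule complete_at_delay) (use delay reach_invariant[OF delay.hyps(1)] in auto)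
next
  case (step q v t w b g R q')
  let ?a = "enc_enta A" and ?v = "\<lambda>c. if c \<in> set R then 0 else v c"
  from step.prems have w: "w = []" and b: "b = None"
    by (auto split: option.splits)
  note inv = reach_invariant[OF step.hyps(1)]
  \<comment> \<open>No delay is involved here, so any threshold in the open unit interval will do;
    1/2 is arbitrary.\<close>
  obtain s where s: "s < nstates ?a" "loc ?a s = q" "in_region ?a s v"
    using ex_ranked_state[of ?a v q "1/2"] inv by auto
  have ar: "areach ?a (nat \<lfloor>v ?a\<rfloor>) s"
    using step.IH[OF w] s by (simp add: complete_at_def)
  have R: "\<And>c. c \<in> set R \<Longrightarrow> c < ?a" and q': "q' < ?a" and e: "enc_edge (q, b, g, R, q') < ?a"
    using edge_less[OF step.hyps(2)] by auto
  have ip: "ip ?a s c < ?a + 3" for c by (simp add: ip_def digit_def)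
  obtain s' where s': "s' < nstates ?a" "loc ?a s' = q'"
    "\<And>c. c \<le> ?a \<Longrightarrow> ip ?a s' c = (if c \<in> set R then 0 else ip ?a s c)"
    "\<And>c. c \<le> ?a \<Longrightarrow> rk ?a s' c = (if c \<in> set R then 0 else rk ?a s c)"
    by (rule ex_state[where K = ?a and q = q' and i = "\<lambda>c. if c \<in> set R then 0 else ip ?a s c"
        and r = "\<lambda>c. if c \<in> set R then 0 else rk ?a s c"])
      (use q' ip rk_less in auto)
  have "enabled ?a s (enc_edge (q, b, g, R, q'))"
    unfolding enabled_enc_enta[OF s(3) inv(1)] using step.hyps s(2) by blast
  then have "silent_step ?a s s'"
    unfolding silent_step_def using e s'
    by (intro exI[of _ "enc_edge (q, b, g, R, q')"]) (auto simp: enc_act_def b less_Suc_eq_le)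
  then have "areach ?a (nat \<lfloor>v ?a\<rfloor>) s'"
    using areach.stay[OF ar s'(1)] by (simp add: stay_def)
  moreover have "?v ?a = v ?a" using R by auto
  moreover have "in_region ?a s' ?v"
  proof -
    have r: "rk ?a s c = 0 \<longleftrightarrow> frac (v c) = 0" "ip ?a s c = min ?a (nat \<lfloor>v c\<rfloor>)"
      "d \<le> ?a \<Longrightarrow> rk ?a s c < rk ?a s d \<longleftrightarrow> frac (v c) < frac (v d)" if "c \<le> ?a" for c d
      using s(3) that by (auto simp: in_region_def)
    have p: "0 < rk ?a s c \<longleftrightarrow> 0 < frac (v c)" if "c \<le> ?a" for c
      using r(1)[OF that] frac_ge_0[of "v c"] by (metis gr0I less_irrefl order_le_less)
    have n: "\<not> frac (v c) < 0" for c by (simp add: not_less)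
    show ?thesis
      unfolding in_region_def using s'(3,4) r p n by (auto simp: r)
  qed
  ultimately show ?case
    by (intro complete_at_rerank[of _ _ s']) (use s'(2) in auto)
qed

section \<open>Soundness of the region graph\<close>

lemma strict_mono_extension:
  fixes h :: "nat \<Rightarrow> real"
  assumes X: "finite X" "0 \<in> X" and h: "strict_mono_on X h" "\<And>x. x \<in> X \<Longrightarrow> h x < 1"
  obtains h' where "strict_mono_on {..<D} h'" "\<And>x. x \<in> X \<Longrightarrow> h' x = h x" "\<And>x. x < D \<Longrightarrow> h' x < 1"
proof -
  \<comment> \<open>The gaps between values of \<open>h\<close> on \<open>X\<close>, together with
    the distances to 1. Their minimum leaves room to fit the missing values above each rank of
    \<open>X\<close> without reaching the next.\<close>
  define Y where "Y = (\<lambda>x. 1 - h x) ` X \<union> (\<lambda>(x, y). h y - h x) ` {(x, y). x \<in> X \<and> y \<in> X \<and> x < y}"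
  have "{(x, y). x \<in> X \<and> y \<in> X \<and> x < y} \<subseteq> X \<times> X" by auto
  then have fin: "finite Y"
    unfolding Y_def using X(1) by (meson finite_SigmaI finite_UnI finite_imageI finite_subset)
  define \<epsilon> where "\<epsilon> = Min Y"
  have ne: "Y \<noteq> {}" using X(2) by (auto simp: Y_def)
  have "\<forall>y\<in>Y. 0 < y"
    using h by (auto simp: Y_def strict_mono_on_def)
  then have pos: "0 < \<epsilon>"
    using fin ne by (simp add: \<epsilon>_def)
  have top: "h x + \<epsilon> \<le> 1" if "x \<in> X" for x
  proof -
    have "1 - h x \<in> Y" using that by (simp add: Y_def)
    then have "\<epsilon> \<le> 1 - h x" unfolding \<epsilon>_def using fin by simp
    then show ?thesis by simp
  qed
  have gap: "h x + \<epsilon> \<le> h y" if "x \<in> X" "y \<in> X" "x < y" for x y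
  proof -
    have "h y - h x \<in> Y" using that by (force simp: Y_def)
    then have "\<epsilon> \<le> h y - h x" unfolding \<epsilon>_def using fin by simp
    then show ?thesis by simp
  qed
  define p where "p r = Max {x \<in> X. x \<le> r}" for r
  have p: "p r \<in> X" "p r \<le> r" for r
  proof -
    have "p r \<in> {x \<in> X. x \<le> r}" unfolding p_def by (rule Max_in) (use X in auto)
    then show "p r \<in> X" "p r \<le> r" by auto
  qed
  have p_mono: "p r \<le> p r'" if "r \<le> r'" for r r'
    unfolding p_def using that X by (intro Max_mono) auto
  have p_id: "p x = x" if "x \<in> X" for x
    unfolding p_def using that X by (intro Max_eqI) auto
  \<comment> \<open>The offset above the nearest rank of \<open>X\<close> from below grows with
    \<open>r\<close>; the denominator \<open>Suc D\<close> keeps it under \<epsilon>.\<close>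
  define h' where "h' r = h (p r) + \<epsilon> * (real (r - p r) / real (Suc D))" for r
  have frac: "0 \<le> \<epsilon> * (real (r - p r) / real (Suc D))" "\<epsilon> * (real (r - p r) / real (Suc D)) < \<epsilon>" if "r < D" for r
    using pos that by (simp_all add: divide_less_eq)
  show thesis
  proof
    show "strict_mono_on {..<D} h'"
    proof (rule strict_mono_onI)
      fix r s assume "r \<in> {..<D}" "s \<in> {..<D}" "r < s"
      then have D: "r < D" "s < D" by simp_all
      show "h' r < h' s"
      proof (cases "p r = p s")
        case True
        then have "real (r - p r) < real (s - p s)"
          using \<open>r < s\<close> p(2)[of r] by simp
        then show ?thesis
          unfolding h'_def True using pos by (simp add: divide_strict_right_mono)
      next
        case False
        then have "p r < p s" using p_mono[of r s] \<open>r < s\<close> by simp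
        from gap[OF p(1) p(1) this] show ?thesis
          unfolding h'_def using frac[OF D(1)] frac[OF D(2)] by linarith
      qed
    qed
    show "h' x = h x" if "x \<in> X" for x
      by (simp add: h'_def p_id that)
    show "h' x < 1" if "x < D" for x
      unfolding h'_def using top[OF p(1)[of x]] frac[OF that] by linarith
  qed
qed

text \<open>Fixes the fractional parts exactly instead of up to order, as a prescribed time of the
  visible action demands. The elapsed time \<open>t\<close> is a separate argument because
  \<open>s\<close> retains only the capped integer part of the clock of absolute time.\<close>

definition realizable :: "enta \<Rightarrow> nat \<Rightarrow> (nat \<Rightarrow> real) \<Rightarrow> real \<Rightarrow> bool" where
  "realizable A s h t \<longleftrightarrow> (\<exists>v. reach A (loc (enc_enta A) s) v t [] \<and>
    (\<forall>c\<le>enc_enta A. frac (v c) = h (rk (enc_enta A) s c) \<and>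
       ip (enc_enta A) s c = min (enc_enta A) (nat \<lfloor>v c\<rfloor>)))"

text \<open>
  A spacing assigns actual fractional parts to the ranks. Soundness is proved for all spacings at
  once: a single representative of the region would not do, since the induction has to go backwards
  through delays and the absolute time of the run is prescribed in the end.
\<close>
definition spacing :: "nat \<Rightarrow> (nat \<Rightarrow> real) \<Rightarrow> bool" where
  "spacing a h \<longleftrightarrow> strict_mono_on {..<a + 3} h \<and> h 0 = 0 \<and> (\<forall>x<a + 3. h x < 1)"

lemma spacing_less: "spacing a h \<Longrightarrow> x < a + 3 \<Longrightarrow> y < a + 3 \<Longrightarrow> h x < h y \<longleftrightarrow> x < y"
  unfolding spacing_def by (metis strict_mono_on_less lessThan_iff)

lemma spacing_in_region:
  assumes "spacing a h" "\<And>c. c \<le> a \<Longrightarrow> frac (v c) = h (rk a s c)"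
    "\<And>c. c \<le> a \<Longrightarrow> ip a s c = min a (nat \<lfloor>v c\<rfloor>)"
  shows "in_region a s v"
proof -
  have "h (rk a s c) = 0 \<longleftrightarrow> rk a s c = 0" for c
    using spacing_less[OF assms(1), of 0 "rk a s c"] assms(1) rk_less[of a s c]
    by (auto simp: spacing_def)
  then show ?thesis
    unfolding in_region_def by (auto simp: assms(2,3) spacing_less[OF assms(1)] rk_less)
qed

lemma realizable_silent_step:
  assumes "silent_step (enc_enta A) s s'" "spacing (enc_enta A) h"
    "realizable A s h (x + h (rk (enc_enta A) s (enc_enta A)))"
  shows "realizable A s' h (x + h (rk (enc_enta A) s' (enc_enta A)))"
proof -
  let ?a = "enc_enta A"
  obtain v where v: "reach A (loc ?a s) v (x + h (rk ?a s ?a)) []"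
    "\<And>c. c \<le> ?a \<Longrightarrow> frac (v c) = h (rk ?a s c)" "\<And>c. c \<le> ?a \<Longrightarrow> ip ?a s c = min ?a (nat \<lfloor>v c\<rfloor>)"
    using assms(3) unfolding realizable_def by blast
  have reg: "in_region ?a s v"
    using spacing_in_region[OF assms(2) v(2,3)] by blast
  obtain e where e: "enabled ?a s e" "nthc e 1 = 0" "loc ?a s' = nthc e 4"
    and s': "\<And>c. c \<le> ?a \<Longrightarrow> if memc c (nthc e 3) then ip ?a s' c = 0 \<and> rk ?a s' c = 0
        else ip ?a s' c = ip ?a s c \<and> rk ?a s' c = rk ?a s c"
    using assms(1) by (auto simp: silent_step_def less_Suc_eq_le)
  obtain b g R q' where edge: "(loc ?a s, b, g, R, q') \<in> set (edges A)" "guard_sat g v"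
    and e': "e = enc_edge (loc ?a s, b, g, R, q')"
    using e(1) unfolding enabled_enc_enta[OF reg reach_invariant(1)[OF v(1)]] by blast
  have "b = None" using e(2) by (simp add: e' enc_act_def split: option.splits)
  with reach.step[OF v(1) edge(1,2)] e(3)
  have "reach A (loc ?a s') (\<lambda>c. if c \<in> set R then 0 else v c) (x + h (rk ?a s ?a)) []"
    by (simp add: e')
  moreover have R: "?a \<notin> set R" using edge_less(5)[OF edge(1)] by blast
  moreover have "rk ?a s' ?a = rk ?a s ?a" using s'[of ?a] R by (simp add: e')
  moreover have "frac (if c \<in> set R then 0 else v c) = h (rk ?a s' c) \<and>
      ip ?a s' c = min ?a (nat \<lfloor>if c \<in> set R then 0 else v c\<rfloor>)" if "c \<le> ?a" for c
    using s'[OF that] v(2,3)[OF that] assms(2) by (auto simp: e' spacing_def)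
  ultimately show ?thesis
    unfolding realizable_def by (intro exI[of _ "\<lambda>c. if c \<in> set R then 0 else v c"]) simp
qed

text \<open>Soundness works backward, so a spacing for \<open>s'\<close> has to be turned into one
  for \<open>s\<close>. Ranks of \<open>s\<close> held by clocks inherit the values, 0 stays 0, and
  the remaining ranks are filled in by \<open>strict_mono_extension\<close>.\<close>

lemma spacing_rerank:
  assumes "rerank a s s'" "spacing a h"
  obtains h' where "spacing a h'" "\<And>c. c \<le> a \<Longrightarrow> h' (rk a s c) = h (rk a s' c)"
proof -
  define X where "X = insert 0 (rk a s ` {..a})"
  \<comment> \<open>Any clock of rank \<open>x\<close> may be selected: clocks of equal rank in
    \<open>s\<close> have equal rank in \<open>s'\<close>.\<close>
  define h0 where "h0 x = (if x = 0 then 0 else h (rk a s' (SOME c. c \<le> a \<and> rk a s c = x)))" for x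
  have zero: "rk a s' c = 0 \<longleftrightarrow> rk a s c = 0" if "c \<le> a" for c
    using assms(1) that by (simp add: rerank_def)
  have less: "rk a s' c < rk a s' d \<longleftrightarrow> rk a s c < rk a s d" if "c \<le> a" "d \<le> a" for c d
    using assms(1) that by (simp add: rerank_def)
  have h: "h 0 = 0" "h x < 1" if "x < a + 3" for x
    using assms(2) that by (simp_all add: spacing_def)
  have h0: "h0 (rk a s c) = h (rk a s' c)" if "c \<le> a" for c
  proof (cases "rk a s c = 0")
    case True
    then show ?thesis using zero[OF that] h(1)[of 0] by (simp add: h0_def)
  next
    case False
    define d where "d = (SOME d. d \<le> a \<and> rk a s d = rk a s c)"
    have "d \<le> a \<and> rk a s d = rk a s c"
      unfolding d_def by (rule someI[of _ c]) (use that in simp)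
    then have "rk a s' d = rk a s' c"
      using less[of c d] less[of d c] that by simp
    then show ?thesis using False by (simp add: h0_def d_def)
  qed
  have pos: "0 < h (rk a s' c)" if "c \<le> a" "0 < rk a s c" for c
    using that zero[OF that(1)] h(1)[of 0] spacing_less[OF assms(2), of 0 "rk a s' c"] rk_less[of a s' c]
    by simp
  have "strict_mono_on X h0"
  proof (rule strict_mono_onI)
    fix x y assume xy: "x \<in> X" "y \<in> X" "x < y"
    then obtain d where d: "y = rk a s d" "d \<le> a" by (auto simp: X_def)
    show "h0 x < h0 y"
    proof (cases "x = 0")
      case True
      then show ?thesis using pos[OF d(2)] d xy(3) h0[OF d(2)] by (simp add: h0_def)
    next
      case False
      then obtain c where c: "x = rk a s c" "c \<le> a" using xy(1) by (auto simp: X_def)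
      then show ?thesis
        using xy(3) d less[of c d] h0 spacing_less[OF assms(2) rk_less rk_less] by simp
    qed
  qed
  moreover have "h0 x < 1" if "x \<in> X" for x
    using that h0 h(2)[OF rk_less] by (auto simp: X_def h0_def)
  moreover have "finite X" "0 \<in> X" by (auto simp: X_def)
  ultimately obtain h' where h': "strict_mono_on {..<a + 3} h'" "\<And>x. x \<in> X \<Longrightarrow> h' x = h0 x"
    "\<And>x. x < a + 3 \<Longrightarrow> h' x < 1"
    by (metis strict_mono_extension)
  show thesis
  proof
    show "spacing a h'" using h' by (simp add: spacing_def X_def h0_def)
    show "h' (rk a s c) = h (rk a s' c)" if "c \<le> a" for c
      using h'(2)[of "rk a s c"] h0[OF that] that by (simp add: X_def)
  qed
qed

lemma realizable_rerank:
  assumes "rerank (enc_enta A) s s'" "\<And>c. c \<le> enc_enta A \<Longrightarrow> h' (rk (enc_enta A) s c) = h (rk (enc_enta A) s' c)"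
    "realizable A s h' t"
  shows "realizable A s' h t"
  using assms unfolding realizable_def rerank_def by (auto simp: less_Suc_eq_le)

text \<open>The spacing before a unit delay of duration \<open>h 1\<close>, if \<open>h\<close> is
  the one after it. Rank \<open>r\<close> moves to \<open>Suc r\<close>, so its earlier value is
  \<open>h (Suc r) - h 1\<close>; the top rank arrives at the next integer, so 1 replaces
  \<open>h (Suc r)\<close>.\<close>

definition shift_spacing :: "nat \<Rightarrow> (nat \<Rightarrow> real) \<Rightarrow> nat \<Rightarrow> real" where
  "shift_spacing a h r = (if r = a + 2 then 1 else h (Suc r)) - h 1"

lemma spacing_shift:
  assumes "spacing a h"
  shows "spacing a (shift_spacing a h)"
proof -
  have h: "h 0 = 0" "\<And>x. x < a + 3 \<Longrightarrow> h x < 1" "0 < h 1"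
    using assms spacing_less[OF assms, of 0 1] by (simp_all add: spacing_def)
  have "shift_spacing a h x < shift_spacing a h y" if "x < a + 3" "y < a + 3" "x < y" for x y
    using that h(2)[of "Suc x"] spacing_less[OF assms, of "Suc x" "Suc y"]
    by (auto simp: shift_spacing_def)
  moreover have "shift_spacing a h x < 1" if "x < a + 3" for x
    using that h(3) h(2)[of "Suc x"] by (auto simp: shift_spacing_def)
  ultimately show ?thesis
    by (auto simp: spacing_def strict_mono_on_def) (simp add: shift_spacing_def)
qed

lemma realizable_unit_delay:
  assumes "unit_delay (enc_enta A) s s'" "spacing (enc_enta A) h"
    "realizable A s (shift_spacing (enc_enta A) h) t"
  shows "realizable A s' h (t + h 1)"
proof -
  let ?a = "enc_enta A"
  obtain v where v: "reach A (loc ?a s) v t []"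
    "\<And>c. c \<le> ?a \<Longrightarrow> frac (v c) = shift_spacing ?a h (rk ?a s c)"
    "\<And>c. c \<le> ?a \<Longrightarrow> ip ?a s c = min ?a (nat \<lfloor>v c\<rfloor>)"
    using assms(3) unfolding realizable_def by blast
  have h: "h 0 = 0" "\<And>x. x < ?a + 3 \<Longrightarrow> h x < 1" "0 < h 1"
    using assms(2) spacing_less[OF assms(2), of 0 1] by (simp_all add: spacing_def)
  have s': "loc ?a s' = loc ?a s" "\<And>c. c \<le> ?a \<Longrightarrow> if rk ?a s c = ?a + 2 then rk ?a s' c = 0 \<and> ip ?a s' c = min ?a (Suc (ip ?a s c))
        else rk ?a s' c = Suc (rk ?a s c) \<and> ip ?a s' c = ip ?a s c"
    using assms(1) by (simp_all add: unit_delay_def less_Suc_eq_le)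
  have "frac (v c + h 1) = h (rk ?a s' c) \<and> ip ?a s' c = min ?a (nat \<lfloor>v c + h 1\<rfloor>)" if c: "c \<le> ?a" for c
  proof (cases "rk ?a s c = ?a + 2")
    case True
    then have f: "frac (v c) = 1 - h 1" using v(2)[OF c] by (simp add: shift_spacing_def)
    have v0: "0 \<le> v c" by (rule reach_invariant(1)[OF v(1)])
    have "\<lfloor>v c + h 1\<rfloor> = \<lfloor>v c\<rfloor> + 1" "frac (v c + h 1) = 0"
      using frac_add_carry[of "h 1" "v c"] f h(3) h(2)[of 1] by simp_all
    then show ?thesis
      using s'(2)[OF c] True v(3)[OF c] h(1) v0 by (simp add: nat_add_distrib min_def)
  next
    case False
    then have f: "frac (v c) = h (Suc (rk ?a s c)) - h 1" using v(2)[OF c] by (simp add: shift_spacing_def)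
    have "Suc (rk ?a s c) < ?a + 3" using False rk_less[of ?a s c] by simp
    then have "h (Suc (rk ?a s c)) < 1" by (rule h(2))
    then have "\<lfloor>v c + h 1\<rfloor> = \<lfloor>v c\<rfloor>" "frac (v c + h 1) = h (Suc (rk ?a s c))"
      using frac_add_no_carry[of "v c" "h 1"] f h(3) h(2)[of 1] by simp_all
    then show ?thesis
      using s'(2)[OF c] False v(3)[OF c] by simp
  qed
  moreover have "reach A (loc ?a s') (\<lambda>c. v c + h 1) (t + h 1) []"
    using reach.delay[OF v(1), of "h 1"] h(3) s'(1) by simp
  ultimately show ?thesis
    unfolding realizable_def by blast
qed

lemma areach_sound:
  assumes "areach (enc_enta A) n s" "spacing (enc_enta A) h"
  shows "realizable A s h (real n + h (rk (enc_enta A) s (enc_enta A)))"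
  using assms
proof (induction arbitrary: h rule: areach.induct)
  case (initial s)
  let ?a = "enc_enta A"
  from initial have "loc ?a s = init A" "\<And>c. c \<le> ?a \<Longrightarrow> ip ?a s c = 0" "\<And>c. c \<le> ?a \<Longrightarrow> rk ?a s c = 0"
    by (auto simp: initial_def less_Suc_eq_le)
  with initial reach.start[of A] show ?case
    unfolding realizable_def spacing_def by (intro exI[of _ "\<lambda>_. 0"]) auto
next
  case (stay n s s')
  let ?a = "enc_enta A"
  consider "silent_step ?a s s'" | "rerank ?a s s'" | "unit_delay ?a s s'" "rk ?a s ?a \<noteq> ?a + 2"
    using stay.hyps by (auto simp: stay_def)
  then show ?case
  proof cases
    case 1
    from realizable_silent_step[OF this stay.prems stay.IH[OF stay.prems]] show ?thesis .
  next
    case 2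
    obtain h' where h': "spacing ?a h'" "\<And>c. c \<le> ?a \<Longrightarrow> h' (rk ?a s c) = h (rk ?a s' c)"
      using spacing_rerank[OF 2 stay.prems] by blast
    from realizable_rerank[OF 2 h'(2) stay.IH[OF h'(1)]] h'(2)[of ?a] show ?thesis
      by simp
  next
    case 3
    then have "rk ?a s' ?a = Suc (rk ?a s ?a)"
      by (auto simp: unit_delay_def dest: spec[of _ ?a])
    with realizable_unit_delay[OF 3(1) stay.prems stay.IH[OF spacing_shift[OF stay.prems]]] 3(2)
    show ?thesis by (simp add: shift_spacing_def)
  qed
next
  case (tick n s s')
  let ?a = "enc_enta A"
  have u: "unit_delay ?a s s'" "rk ?a s ?a = ?a + 2"
    using tick.hyps by (auto simp: tick_def)
  then have "rk ?a s' ?a = 0"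
    by (auto simp: unit_delay_def dest: spec[of _ ?a])
  \<comment> \<open>Before the tick the time is \<open>real n + (1 - h 1)\<close>; the delay
    \<open>h 1\<close> makes it \<open>real (Suc n)\<close>, in accordance with the new rank 0 of
    clock \<open>?a\<close>.\<close>
  with realizable_unit_delay[OF u(1) tick.prems tick.IH[OF spacing_shift[OF tick.prems]]] u(2) tick.prems
  show ?case by (simp add: shift_spacing_def spacing_def add.commute)
qed

section \<open>Times of the first visible action\<close>

lemma reach_singleton_split:
  assumes "reach A q v t w" "w = [(\<tau>, l)]"
  shows "\<exists>q v g R q'. reach A q v \<tau> [] \<and> (q, Some l, g, R, q') \<in> set (edges A) \<and> guard_sat g v"
  using assms
proof (induction rule: reach.induct)
  case (step q v t w b g R q')
  then show ?case
  proof (cases b)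
    case (Some l')
    with step.prems have "w = []" "t = \<tau>" "l' = l" by auto
    with step.hyps Some show ?thesis by blast
  qed auto
qed auto

text \<open>The time \<open>t\<close> enters the right-hand side only through its floor and its
  integrality: once the rank of the absolute clock is positive, soundness allows its fraction to be
  any value in the open unit interval.\<close>

lemma singleton_in_lang:
  "[(t, l)] \<in> lang A \<longleftrightarrow> 0 \<le> t \<and>
     (\<exists>s. areach (enc_enta A) (nat \<lfloor>t\<rfloor>) s \<and> (rk (enc_enta A) s (enc_enta A) = 0 \<longleftrightarrow> frac t = 0) \<and>
        emits (enc_enta A) s l)"
  (is "_ \<longleftrightarrow> _ \<and> (\<exists>s. ?P s)")
proof
  let ?a = "enc_enta A"
  assume "[(t, l)] \<in> lang A"
  then obtain q v g R q' where r: "reach A q v t []" and e: "(q, Some l, g, R, q') \<in> set (edges A)" "guard_sat g v"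
    unfolding lang_def using reach_singleton_split by blast
  note inv = reach_invariant[OF r]
  obtain s where s: "s < nstates ?a" "loc ?a s = q" "in_region ?a s v"
    using ex_ranked_state[of ?a v q "1/2"] inv by auto
  have "areach ?a (nat \<lfloor>v ?a\<rfloor>) s"
    using reach_complete[OF r refl] s by (simp add: complete_at_def)
  moreover have "rk ?a s ?a = 0 \<longleftrightarrow> frac (v ?a) = 0"
    using s(3) by (simp add: in_region_def)
  moreover have "v ?a = t" by (rule inv(3)) simp
  ultimately have "areach ?a (nat \<lfloor>t\<rfloor>) s" "rk ?a s ?a = 0 \<longleftrightarrow> frac t = 0" by simp_all
  moreover have "emits ?a s l"
    unfolding emits_enc_enta[OF s(3) inv(1)] using e s(2) by blast
  ultimately have P: "?P s" by (intro conjI)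
  have "\<exists>s. ?P s" by (rule exI[where P = ?P, OF P])
  with inv(2) show "0 \<le> t \<and> (\<exists>s. ?P s)" by (rule conjI)
next
  let ?a = "enc_enta A"
  assume "0 \<le> t \<and> (\<exists>s. ?P s)"
  then obtain s where t: "0 \<le> t" and s: "areach ?a (nat \<lfloor>t\<rfloor>) s" "rk ?a s ?a = 0 \<longleftrightarrow> frac t = 0"
    "emits ?a s l" by (elim conjE exE)
  \<comment> \<open>Only the ranks 0 and that of the absolute clock are prescribed; the other ranks
    are free.\<close>
  define h0 where "h0 x = (if x = 0 then 0 else frac t)" for x :: nat
  have "finite {0, rk ?a s ?a}" "0 \<in> {0, rk ?a s ?a}" by auto
  moreover have "strict_mono_on {0, rk ?a s ?a} h0"
  proof (rule strict_mono_onI)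
    fix x y assume "x \<in> {0, rk ?a s ?a}" "y \<in> {0, rk ?a s ?a}" "x < y"
    then have xy: "x = 0" "y = rk ?a s ?a" "0 < y" by auto
    with s(2) have "0 < frac t" using frac_ge_0[of t] by linarith
    with xy show "h0 x < h0 y" by (simp add: h0_def)
  qed
  moreover have "\<And>x. x \<in> {0, rk ?a s ?a} \<Longrightarrow> h0 x < 1"
    by (auto simp: h0_def frac_lt_1)
  ultimately obtain h where h: "strict_mono_on {..<?a + 3} h" "\<And>x. x \<in> {0, rk ?a s ?a} \<Longrightarrow> h x = h0 x"
    "\<And>x. x < ?a + 3 \<Longrightarrow> h x < 1"
    using strict_mono_extension[of "{0, rk ?a s ?a}" h0 "?a + 3"] by blast
  have sp: "spacing ?a h" using h by (simp add: spacing_def h0_def)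
  have "h (rk ?a s ?a) = frac t"
    using h(2)[of "rk ?a s ?a"] s(2) unfolding h0_def by (metis insertI1 insert_commute)
  then have "real (nat \<lfloor>t\<rfloor>) + h (rk ?a s ?a) = t"
    using nat_floor_frac[OF t] by linarith
  with areach_sound[OF s(1) sp] have "realizable A s h t" by simp
  then obtain v where v: "reach A (loc ?a s) v t []"
    "\<And>c. c \<le> ?a \<Longrightarrow> frac (v c) = h (rk ?a s c)" "\<And>c. c \<le> ?a \<Longrightarrow> ip ?a s c = min ?a (nat \<lfloor>v c\<rfloor>)"
    unfolding realizable_def by blast
  have "in_region ?a s v" using spacing_in_region[OF sp v(2,3)] by blast
  from s(3)[unfolded emits_enc_enta[OF this reach_invariant(1)[OF v(1)]]]
  obtain g R q' where "(loc ?a s, Some l, g, R, q') \<in> set (edges A)" "guard_sat g v" by blast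
  from reach.step[OF v(1) this] show "[(t, l)] \<in> lang A"
    unfolding lang_def by auto
qed

section \<open>Reachable regions and the decision procedure\<close>

definition setc :: "nat \<Rightarrow> (nat \<Rightarrow> bool) \<Rightarrow> nat" where
  "setc b P = (\<Sum>s<b. if P s then 2 ^ s else 0)"

definition inset :: "nat \<Rightarrow> nat \<Rightarrow> bool" where
  "inset s X \<longleftrightarrow> odd (X div 2 ^ s)"

lemma inset_setc [simp]: "inset s (setc b P) \<longleftrightarrow> s < b \<and> P s"
proof -
  have "setc b P = set_encode {s \<in> {..<b}. P s}"
    unfolding setc_def set_encode_def by (rule sum.inter_filter[symmetric]) simp
  then have "set_decode (setc b P) = {s \<in> {..<b}. P s}"
    by simp
  then show ?thesis by (auto simp: inset_def set_decode_def)
qed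

lemma setc_less: "setc b P < 2 ^ b"
proof -
  have "setc b P \<le> (\<Sum>s<b. 2 ^ s)"
    unfolding setc_def by (rule sum_mono) simp
  also have "\<dots> < 2 ^ b" by (induction b) auto
  finally show ?thesis .
qed

definition expand :: "nat \<Rightarrow> nat \<Rightarrow> nat" where
  "expand a X = setc (nstates a) (\<lambda>s. inset s X \<or> (\<exists>s'<nstates a. inset s' X \<and> stay a s' s))"

text \<open>\<open>expand\<close> keeps the states of its argument, so \<open>k\<close> rounds
  collect all paths of length at most \<open>k\<close>. A shortest path is no longer than the number
  of pairs in the relation, which is at most the square of the number of states.\<close>

definition closure :: "nat \<Rightarrow> nat \<Rightarrow> nat" where
  "closure a X = (expand a ^^ (nstates a * nstates a)) X"

primrec level :: "nat \<Rightarrow> nat \<Rightarrow> nat" where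
  "level a 0 = closure a (setc (nstates a) (initial a))"
| "level a (Suc n) = closure a (setc (nstates a) (\<lambda>s. \<exists>s'<nstates a. inset s' (level a n) \<and> tick a s' s))"

lemma inset_closure:
  assumes "\<And>s. inset s X \<Longrightarrow> s < nstates a"
  shows "inset s (closure a X) \<longleftrightarrow> (\<exists>s0. inset s0 X \<and> (s0, s) \<in> {(s, s'). s < nstates a \<and> s' < nstates a \<and> stay a s s'}\<^sup>*)"
proof -
  let ?N = "nstates a"
  define R where "R = {(s, s'). s < ?N \<and> s' < ?N \<and> stay a s s'}"
  have iter: "inset s ((expand a ^^ k) X) \<longleftrightarrow> (\<exists>s0 j. j \<le> k \<and> inset s0 X \<and> (s0, s) \<in> R ^^ j)" for k s
  proof (induction k arbitrary: s)
    case (Suc k)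
    have less: "s < ?N" if "inset s0 X" "(s0, s) \<in> R ^^ j" for s0 j
      using that assms by (cases j) (auto simp: R_def)
    have "inset s ((expand a ^^ Suc k) X) \<longleftrightarrow> s < ?N \<and> ((\<exists>s0 j. j \<le> k \<and> inset s0 X \<and> (s0, s) \<in> R ^^ j) \<or>
        (\<exists>s' s0 j. s' < ?N \<and> stay a s' s \<and> j \<le> k \<and> inset s0 X \<and> (s0, s') \<in> R ^^ j))"
      unfolding funpow.simps o_apply expand_def inset_setc Suc by blast
    also have "\<dots> \<longleftrightarrow> (\<exists>s0 j. j \<le> Suc k \<and> inset s0 X \<and> (s0, s) \<in> R ^^ j)" (is "?L \<longleftrightarrow> ?R")
    proof
      assume ?L
      then consider s0 j where "j \<le> k" "inset s0 X" "(s0, s) \<in> R ^^ j"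
        | s' s0 j where "s < ?N" "s' < ?N" "stay a s' s" "j \<le> k" "inset s0 X" "(s0, s') \<in> R ^^ j"
        by blast
      then show ?R
      proof cases
        case 1
        then show ?thesis by (meson le_SucI)
      next
        case 2
        then have "(s0, s) \<in> R ^^ Suc j" by (auto simp: R_def)
        with 2 show ?thesis by (meson Suc_le_mono)
      qed
    next
      assume ?R
      then obtain s0 j where j: "j \<le> Suc k" "inset s0 X" "(s0, s) \<in> R ^^ j" by blast
      show ?L
      proof (cases "j \<le> k")
        case True
        with j less[OF j(2,3)] show ?thesis by blast
      next
        case False
        with j have "(s0, s) \<in> R ^^ Suc k" by (simp add: le_Suc_eq)
        then obtain s' where "(s0, s') \<in> R ^^ k" "(s', s) \<in> R" by auto
        with j(2) show ?thesis by (auto simp: R_def)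
      qed
    qed
    finally show ?case .
  qed auto
  have "R \<subseteq> {..<?N} \<times> {..<?N}" by (auto simp: R_def)
  then have "finite R" "card R \<le> ?N * ?N"
    using card_mono[of "{..<?N} \<times> {..<?N}" R] by (auto intro: finite_subset)
  then have "(s0, s) \<in> R\<^sup>* \<longleftrightarrow> (\<exists>j\<le>?N * ?N. (s0, s) \<in> R ^^ j)" for s0
    using relpow_imp_rtrancl[of "(s0, s)" _ R] by (auto simp: rtrancl_finite_eq_relpow intro: order_trans)
  then show ?thesis
    unfolding closure_def iter R_def by blast
qed

definition stays :: "nat \<Rightarrow> (nat \<times> nat) set" where
  "stays a = {(s, s'). s < nstates a \<and> s' < nstates a \<and> stay a s s'}"

lemma inset_closure_setc:
  "inset s (closure a (setc (nstates a) P)) \<longleftrightarrow> (\<exists>s0<nstates a. P s0 \<and> (s0, s) \<in> (stays a)\<^sup>*)"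
  by (subst inset_closure) (auto simp: stays_def)

lemma inset_level_Suc:
  "inset s (level a (Suc n)) \<longleftrightarrow>
     (\<exists>s0<nstates a. (\<exists>s'<nstates a. inset s' (level a n) \<and> tick a s' s0) \<and> (s0, s) \<in> (stays a)\<^sup>*)"
  unfolding level.simps by (rule inset_closure_setc)

lemma inset_level_0: "inset s (level a 0) \<longleftrightarrow> (\<exists>s0<nstates a. initial a s0 \<and> (s0, s) \<in> (stays a)\<^sup>*)"
  unfolding level.simps by (rule inset_closure_setc)

lemma inset_level: "inset s (level a n) \<longleftrightarrow> areach a n s"
proof
  have stays: "areach a n s" if "(s0, s) \<in> (stays a)\<^sup>*" "areach a n s0" for s0 s n
    using that by (induction rule: rtrancl_induct) (auto intro: areach.stay simp: stays_def)
  show "areach a n s" if "inset s (level a n)"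
    using that
  proof (induction n arbitrary: s)
    case 0
    then obtain s0 where "s0 < nstates a" "initial a s0" "(s0, s) \<in> (stays a)\<^sup>*"
      unfolding inset_level_0 by blast
    then show ?case using stays areach.initial by blast
  next
    case (Suc n)
    from Suc.prems obtain s0 s' where "s0 < nstates a" "inset s' (level a n)" "tick a s' s0" "(s0, s) \<in> (stays a)\<^sup>*"
      unfolding inset_level_Suc by blast
    then show ?case using stays areach.tick Suc.IH by blast
  qed
  show "inset s (level a n)" if "areach a n s"
    using that
  proof (induction rule: areach.induct)
    case (initial s)
    then show ?case unfolding inset_level_0 by blast
  next
    case (stay n s s')
    have "s < nstates a" using stay.hyps(1) by (rule areach_less)
    with stay.hyps have "(s, s') \<in> stays a" by (simp add: stays_def)
    then have "(s0, s') \<in> (stays a)\<^sup>*" if "(s0, s) \<in> (stays a)\<^sup>*" for s0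
      using that by (rule rtrancl.rtrancl_into_rtrancl[rotated])
    with stay.IH show ?case
      by (cases n) (simp only: inset_level_0 inset_level_Suc, blast)+
  next
    case (tick n s s')
    have "s < nstates a" using tick.hyps(1) by (rule areach_less)
    with tick show ?case unfolding inset_level_Suc by blast
  qed
qed

section \<open>Periodicity of the levels and the inclusion test\<close>

lemma level_less: "level a n < 2 ^ nstates a"
proof -
  \<comment> \<open>At least one round of \<open>expand\<close> takes place, and its result is a
    mask of \<open>nstates a\<close> bits whatever the argument.\<close>
  have "0 < nstates a * nstates a" by (simp add: nstates_def)
  then obtain k where "nstates a * nstates a = Suc k" by (metis gr0_conv_Suc)
  then have "closure a X < 2 ^ nstates a" for X
    by (simp add: closure_def expand_def setc_less)
  then show ?thesis by (cases n) auto
qed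

text \<open>Each value determines the next, so a repetition \<open>f i = f j\<close> with
  \<open>i < j <= m\<close> would produce the value \<open>f m\<close> already at the smaller index
  \<open>i + (m - j)\<close>. For the least index \<open>m\<close> of a given value the first
  \<open>m + 1\<close> values are therefore distinct, and the pigeonhole principle applies.\<close>

lemma iterates_in_finite_set:
  fixes f :: "nat \<Rightarrow> 'a"
  assumes "\<And>n. f (Suc n) = G (f n)" "\<And>n. f n \<in> S" "finite S"
  shows "\<exists>m<card S. f m = f n"
proof -
  define m where "m = (LEAST m. f m = f n)"
  have m: "f m = f n" unfolding m_def by (rule LeastI[of _ n]) simp
  have least: "f k \<noteq> f n" if "k < m" for k
    using not_less_Least that unfolding m_def by blast
  have shift: "f (i + k) = f (j + k)" if "f i = f j" for i j k
    using that by (induction k) (simp_all add: assms(1))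
  have "inj_on f {..m}"
  proof (rule linorder_inj_onI)
    fix i j assume ij: "i < j" "i \<in> {..m}" "j \<in> {..m}"
    show "f i \<noteq> f j"
    proof
      assume "f i = f j"
      from shift[OF this, of "m - j"] ij m have "f (i + (m - j)) = f n" by simp
      moreover have "i + (m - j) < m" using ij by simp
      ultimately show False using least by blast
    qed
  qed auto
  then have "card {..m} \<le> card S"
    using assms(2,3) by (intro card_inj_on_le) auto
  then show ?thesis using m by (intro exI[of _ m]) simp
qed

text \<open>
  \<open>z = 0\<close> stands for the time point \<open>n\<close>, any other \<open>z\<close> for the open interval from \<open>n\<close> to \<open>n + 1\<close>,
  when \<open>X\<close> is the set of regions reachable with counter \<open>n\<close>.
\<close>
definition accepts :: "nat \<Rightarrow> nat \<Rightarrow> nat \<Rightarrow> nat \<Rightarrow> bool" where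
  "accepts a X z l \<longleftrightarrow> (\<exists>s<nstates a. inset s X \<and> (rk a s a = 0 \<longleftrightarrow> z = 0) \<and> emits a s l)"

text \<open>Levels are compared at equal \<open>n\<close>, so it is the pair of levels that has to
  recur; the bound on \<open>n\<close> is the number of such pairs of masks. Labels below
  \<open>a\<close> suffice, since the action code \<open>Suc l\<close> of an edge is less than the
  code of its automaton.\<close>

definition included :: "nat \<Rightarrow> nat \<Rightarrow> bool" where
  "included a b \<longleftrightarrow> (\<forall>n<2 ^ nstates a * 2 ^ nstates b. \<forall>z<2. \<forall>l<a.
     accepts a (level a n) z l \<longrightarrow> accepts b (level b n) z l)"

lemma singleton_in_lang_accepts:
  "[(t, l)] \<in> lang A \<longleftrightarrow>
     0 \<le> t \<and> accepts (enc_enta A) (level (enc_enta A) (nat \<lfloor>t\<rfloor>)) (if frac t = 0 then 0 else 1) l"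
  unfolding singleton_in_lang accepts_def inset_level by (auto dest: areach_less)

lemma included_iff: "lang1 A1 \<subseteq> lang1 A2 \<longleftrightarrow> included (enc_enta A1) (enc_enta A2)"
proof
  let ?a = "enc_enta A1" and ?b = "enc_enta A2"
  assume sub: "lang1 A1 \<subseteq> lang1 A2"
  show "included ?a ?b"
    unfolding included_def
  proof (intro allI impI)
    fix n z l :: nat
    assume z: "z < 2" and acc: "accepts ?a (level ?a n) z l"
    \<comment> \<open>A representative of the point or interval: the integer itself or the
      midpoint.\<close>
    define t where "t = real n + (if z = 0 then 0 else 1/2)"
    have t: "0 \<le> t" "nat \<lfloor>t\<rfloor> = n" "(if frac t = 0 then 0 else 1) = z"
    proof -
      have fl: "\<lfloor>t\<rfloor> = int n" unfolding t_def by (rule floor_unique) auto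
      then show "nat \<lfloor>t\<rfloor> = n" by simp
      show "0 \<le> t" by (simp add: t_def)
      show "(if frac t = 0 then 0 else 1) = z"
        unfolding frac_def fl using z by (simp add: t_def)
    qed
    have "[(t, l)] \<in> lang A1"
      unfolding singleton_in_lang_accepts t using t(1) acc by simp
    then have "[(t, l)] \<in> lang1 A2" using sub by (auto simp: lang1_def)
    then show "accepts ?b (level ?b n) z l"
      unfolding lang1_def mem_Collect_eq singleton_in_lang_accepts t by blast
  qed
next
  let ?a = "enc_enta A1" and ?b = "enc_enta A2"
  assume inc: "included ?a ?b"
  define f where "f n = (level ?a n, level ?b n)" for n
  let ?S = "{..<2 ^ nstates ?a :: nat} \<times> {..<2 ^ nstates ?b :: nat}"
  have "\<exists>G. \<forall>n. f (Suc n) = G (f n)"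
    unfolding f_def level.simps
    by (rule exI[of _ "\<lambda>(X, Y).
        (closure ?a (setc (nstates ?a) (\<lambda>s. \<exists>s'<nstates ?a. inset s' X \<and> tick ?a s' s)),
         closure ?b (setc (nstates ?b) (\<lambda>s. \<exists>s'<nstates ?b. inset s' Y \<and> tick ?b s' s)))"]) simp
  then obtain G where G: "\<And>n. f (Suc n) = G (f n)" by blast
  have acc: "accepts ?b (level ?b n) z l" if "accepts ?a (level ?a n) z l" "z < 2" "l < ?a" for n z l
  proof -
    have "\<exists>m<card ?S. f m = f n"
      by (rule iterates_in_finite_set[where f = f and G = G, OF G]) (auto simp: f_def level_less)
    then obtain m where "m < 2 ^ nstates ?a * 2 ^ nstates ?b" "f m = f n" by auto
    with inc that show ?thesis by (auto simp: included_def f_def)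
  qed
  show "lang1 A1 \<subseteq> lang1 A2"
  proof
    fix w assume w: "w \<in> lang1 A1"
    then consider "w = []" | t l where "w = [(t, l)]"
      unfolding lang1_def by (cases w) auto
    then show "w \<in> lang1 A2"
    proof cases
      case 1
      then show ?thesis using reach.start[of A2] by (auto simp: lang1_def lang_def)
    next
      case 2
      with w have t: "[(t, l)] \<in> lang A1" by (simp add: lang1_def)
      then obtain q g R q' where "(q, Some l, g, R, q') \<in> set (edges A1)"
        unfolding lang_def using reach_singleton_split by blast
      from edge_less(4)[OF this] have "l < ?a" by (simp add: enc_act_def)
      with t acc have "[(t, l)] \<in> lang A2"
        by (simp add: singleton_in_lang_accepts)
      with 2 show ?thesis by (simp add: lang1_def)
    qed
  qed
qed

section \<open>Computability of the inclusion test\<close>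

lemma decidable_comp2:
  assumes "decidable (\<lambda>z. P (pfst z) (psnd z))" "computable f" "computable g"
  shows "decidable (\<lambda>x. P (f x) (g x))"
  using decidable_comp[OF assms(1) computable_prod_encode[OF assms(2,3)]] by simp

lemma decidable_comp3:
  assumes "decidable (\<lambda>z. P (pfst z) (pfst (psnd z)) (psnd (psnd z)))" "computable f" "computable g" "computable h"
  shows "decidable (\<lambda>x. P (f x) (g x) (h x))"
  using decidable_comp[OF assms(1) computable_prod_encode[OF assms(2) computable_prod_encode[OF assms(3,4)]]]
  by simp

lemma computable_comp3:
  assumes "computable (\<lambda>z. f (pfst z) (pfst (psnd z)) (psnd (psnd z)))" "computable g" "computable h" "computable k"
  shows "computable (\<lambda>x. f (g x) (h x) (k x))"
  using computable_comp[OF assms(1) computable_prod_encode[OF assms(2) computable_prod_encode[OF assms(3,4)]]]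
  by simp

text \<open>The pattern of most lemmas below: a composition rule reduces several arguments to
  projections of one number, and unfolding the definition leaves only operations known to
  \<open>computable_intros\<close>, a collection that each new lemma extends.\<close>

lemma computable_dropc [computable_intros]:
  "computable f \<Longrightarrow> computable g \<Longrightarrow> computable (\<lambda>x. dropc (f x) (g x))"
  by (rule computable_comp2[where f = dropc]) (unfold dropc_def, intro computable_intros)

lemma computable_nthc [computable_intros]:
  "computable f \<Longrightarrow> computable g \<Longrightarrow> computable (\<lambda>x. nthc (f x) (g x))"
  by (rule computable_comp2[where f = nthc]) (unfold nthc_def, intro computable_intros)

lemma decidable_memc [computable_intros]:
  "computable f \<Longrightarrow> computable g \<Longrightarrow> decidable (\<lambda>x. memc (f x) (g x))"
  by (rule decidable_comp2[where P = memc]) (unfold memc_def, intro computable_intros)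

lemma computable_digit [computable_intros]:
  "computable f \<Longrightarrow> computable g \<Longrightarrow> computable h \<Longrightarrow> computable (\<lambda>x. digit (f x) (g x) (h x))"
  by (rule computable_comp3[where f = digit]) (unfold digit_def, intro computable_intros)

lemma computable_loc [computable_intros]:
  "computable f \<Longrightarrow> computable g \<Longrightarrow> computable (\<lambda>x. loc (f x) (g x))"
  by (rule computable_comp2[where f = loc]) (unfold loc_def, intro computable_intros)

lemma computable_ip [computable_intros]:
  "computable f \<Longrightarrow> computable g \<Longrightarrow> computable h \<Longrightarrow> computable (\<lambda>x. ip (f x) (g x) (h x))"
  by (rule computable_comp3[where f = ip]) (unfold ip_def, intro computable_intros)

lemma computable_rk [computable_intros]:
  "computable f \<Longrightarrow> computable g \<Longrightarrow> computable h \<Longrightarrow> computable (\<lambda>x. rk (f x) (g x) (h x))"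
  by (rule computable_comp3[where f = rk]) (unfold rk_def, intro computable_intros)

lemma computable_nstates [computable_intros]:
  "computable f \<Longrightarrow> computable (\<lambda>x. nstates (f x))"
  by (rule computable_comp[where f = nstates]) (unfold nstates_def, intro computable_intros)

lemma decidable_asat [computable_intros]:
  "computable f \<Longrightarrow> computable g \<Longrightarrow> computable h \<Longrightarrow> decidable (\<lambda>x. asat (f x) (g x) (h x))"
  by (rule decidable_comp3[where P = asat]) (unfold asat_def, intro computable_intros)

lemma decidable_rerank [computable_intros]:
  "computable f \<Longrightarrow> computable g \<Longrightarrow> computable h \<Longrightarrow> decidable (\<lambda>x. rerank (f x) (g x) (h x))"
  by (rule decidable_comp3[where P = rerank]) (unfold rerank_def, intro computable_intros)

lemma decidable_enabled [computable_intros]: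
  "computable f \<Longrightarrow> computable g \<Longrightarrow> computable h \<Longrightarrow> decidable (\<lambda>x. enabled (f x) (g x) (h x))"
  by (rule decidable_comp3[where P = enabled]) (unfold enabled_def, intro computable_intros)

lemma decidable_silent_step [computable_intros]:
  "computable f \<Longrightarrow> computable g \<Longrightarrow> computable h \<Longrightarrow> decidable (\<lambda>x. silent_step (f x) (g x) (h x))"
  by (rule decidable_comp3[where P = silent_step]) (unfold silent_step_def, intro computable_intros)

lemma decidable_emits [computable_intros]:
  "computable f \<Longrightarrow> computable g \<Longrightarrow> computable h \<Longrightarrow> decidable (\<lambda>x. emits (f x) (g x) (h x))"
  by (rule decidable_comp3[where P = emits]) (unfold emits_def, intro computable_intros)

lemma decidable_unit_delay [computable_intros]:
  "computable f \<Longrightarrow> computable g \<Longrightarrow> computable h \<Longrightarrow> decidable (\<lambda>x. unit_delay (f x) (g x) (h x))"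
  by (rule decidable_comp3[where P = unit_delay]) (unfold unit_delay_def, intro computable_intros)

lemma decidable_initial [computable_intros]:
  "computable f \<Longrightarrow> computable g \<Longrightarrow> decidable (\<lambda>x. initial (f x) (g x))"
  by (rule decidable_comp2[where P = initial]) (unfold initial_def, intro computable_intros)

lemma decidable_stay [computable_intros]:
  "computable f \<Longrightarrow> computable g \<Longrightarrow> computable h \<Longrightarrow> decidable (\<lambda>x. stay (f x) (g x) (h x))"
  by (rule decidable_comp3[where P = stay]) (unfold stay_def, intro computable_intros)

lemma decidable_tick [computable_intros]:
  "computable f \<Longrightarrow> computable g \<Longrightarrow> computable h \<Longrightarrow> decidable (\<lambda>x. tick (f x) (g x) (h x))"
  by (rule decidable_comp3[where P = tick]) (unfold tick_def, intro computable_intros)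

lemma computable_setc [computable_intros]:
  assumes "computable b" "decidable (\<lambda>z. P (pfst z) (psnd z))"
  shows "computable (\<lambda>x. setc (b x) (P x))"
  unfolding setc_def by (intro computable_sum computable_if computable_power computable_intros assms)

lemma decidable_inset [computable_intros]:
  "computable f \<Longrightarrow> computable g \<Longrightarrow> decidable (\<lambda>x. inset (f x) (g x))"
  by (rule decidable_comp2[where P = inset]) (unfold inset_def, intro computable_intros)

lemma computable_expand [computable_intros]:
  "computable f \<Longrightarrow> computable g \<Longrightarrow> computable (\<lambda>x. expand (f x) (g x))"
  by (rule computable_comp2[where f = expand]) (unfold expand_def, intro computable_intros)

lemma computable_closure [computable_intros]:
  "computable f \<Longrightarrow> computable g \<Longrightarrow> computable (\<lambda>x. closure (f x) (g x))"
  by (rule computable_comp2[where f = closure]) (unfold closure_def, intro computable_intros)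

lemma computable_level [computable_intros]:
  "computable f \<Longrightarrow> computable g \<Longrightarrow> computable (\<lambda>x. level (f x) (g x))"
proof (rule computable_comp2[where f = level])
  show "computable (\<lambda>z. level (pfst z) (psnd z))"
  proof (rule computable_rec_nat'[where h = "\<lambda>x. level (pfst x)" and b = psnd and
        g = "\<lambda>x n r. closure (pfst x) (setc (nstates (pfst x)) (\<lambda>s. \<exists>s'<nstates (pfst x). inset s' r \<and> tick (pfst x) s' s))"])
    show "computable psnd" by (intro computable_intros)
  qed (simp_all only: level.simps, (intro computable_intros)+)
qed

lemma decidable_accepts [computable_intros]:
  "computable f \<Longrightarrow> computable g \<Longrightarrow> computable h \<Longrightarrow> computable k \<Longrightarrow>
    decidable (\<lambda>x. accepts (f x) (g x) (h x) (k x))"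
proof -
  have "decidable (\<lambda>z. accepts (pfst (pfst z)) (psnd (pfst z)) (pfst (psnd z)) (psnd (psnd z)))"
    unfolding accepts_def by (intro computable_intros)
  from decidable_comp[OF this, of "\<lambda>x. prod_encode (prod_encode (f x, g x), prod_encode (h x, k x))"]
  show "computable f \<Longrightarrow> computable g \<Longrightarrow> computable h \<Longrightarrow> computable k \<Longrightarrow>
    decidable (\<lambda>x. accepts (f x) (g x) (h x) (k x))"
    by (simp add: computable_prod_encode)
qed

lemma decidable_included: "decidable (\<lambda>z. included (pfst z) (psnd z))"
  unfolding included_def by (intro computable_intros)

theorem theorem4:
  "\<exists>f :: recf. \<forall>A1 A2. wf_enta A1 \<longrightarrow> wf_enta A2 \<longrightarrow> set (acts A1) = set (acts A2) \<longrightarrow>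
      eval f [enc_enta A1, enc_enta A2] (if lang1 A1 \<subseteq> lang1 A2 then 1 else 0)"
proof -
  define F where "F z = (if included (pfst z) (psnd z) then 1 else 0 :: nat)" for z
  have "rec_fun 1 (\<lambda>xs. F (xs ! 0))"
    using decidable_included unfolding decidable_def computable_def F_def .
  \<comment> \<open>\<open>eval\<close> expects the two codes as separate arguments, whereas
    \<open>F\<close> works on their pair.\<close>
  then have "rec_fun 2 (\<lambda>xs. F (prod_encode (xs ! 0, xs ! 1)))"
    by (rule rec_fun_comp1[where f = F]) (intro rec_fun_prod_encode rec_fun_nth, simp_all)
  then obtain f where f: "\<And>xs. length xs = 2 \<Longrightarrow> eval f xs (F (prod_encode (xs ! 0, xs ! 1)))"
    unfolding rec_fun_def by blast
  have "eval f [enc_enta A1, enc_enta A2] (if lang1 A1 \<subseteq> lang1 A2 then 1 else 0)" for A1 A2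
    using f[of "[enc_enta A1, enc_enta A2]"] by (simp add: F_def included_iff)
  then show ?thesis by blast
qed

end
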